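(* Every skeletally generated space is weakly $\kappa$-metrizable.
   Context: All topological spaces are assumed Tychonoff and all maps continuous. A set $C\subset X$ is regularly closed if it is the closure of an open set; $\mathcal C$ denotes the family of all regularly closed subsets of $X$. Weakly $\kappa$-metrizable: a non-negative function $d:X\times\mathcal C\to\mathbb R$ is a weak $\kappa$-metric on $X$ if: K1)$^*$ for any $C\in\mathcal C$ there is a dense open subset $V$ of $X\setminus C$ such that $d(x,C)>0$ iff $x\in V$; K2) if $C\subset C'$, then $d(x,C')\le d(x,C)$ for every $x\in X$; K3) for every $C$, $d(x,C)$ is a continuous function of $x$; K4)$_0$ for every increasing transfinite (i.e. well-ordered by index) family $\{C_\alpha\}_\alpha\subset\mathcal C$ the function $f(x)=\inf_\alpha d(x,C_\alpha)$ is continuous. $X$ is weakly $\kappa$-metrizable if it admits a weak $\kappa$-metric. Skeletally generated: a map $f:X\to Y$ is skeletal if $\mathrm{Int}\,\overline{f(U)}\ne\varnothing$ for every non-empty open $U\subset X$. A space $X$ is skeletally generated if there is an inverse system $S=\{X_\alpha,p^\beta_\alpha,A\}$ of separable metric spaces $X_\alpha$ with skeletal surjective bonding maps $p^\beta_\alpha:X_\beta\to X_\alpha$ ($\alpha\le\beta$ in the directed set $A$) such that: (1) $A$ is $\sigma$-complete, i.e. every countable chain in $A$ has a supremum in $A$; (2) for every countable chain $\{\alpha_n\}_{n\ge1}\subset A$ with $\beta=\sup\{\alpha_n\}_{n\ge 1}$, the space $X_\beta$ is (via the canonical map induced by the $p^\beta_{\alpha_n}$) a (dense) subset of $\varprojlim\{X_{\alpha_n},p^{\alpha_{n+1}}_{\alpha_n}\}$;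 (3) $X$ is embedded in $\varprojlim S$ and $p_\alpha(X)=X_\alpha$ for each $\alpha$, where $p_\alpha:\varprojlim S\to X_\alpha$ is the $\alpha$-th limit projection. *)

theory Defs
  imports "HOL-Analysis.Analysis"
begin

section \<open>Weakly kappa-metrizable spaces\<close>

definition tychonoff_space :: "'a topology \<Rightarrow> bool" where
  "tychonoff_space X \<longleftrightarrow> completely_regular_space X \<and> Hausdorff_space X"

definition regularly_closedin :: "'a topology \<Rightarrow> 'a set \<Rightarrow> bool" where
  "regularly_closedin X C \<longleftrightarrow> (\<exists>U. openin X U \<and> C = X closure_of U)"

text \<open>
  The clauses after non-negativity are K1*, K2, K3 and K4_0, in this order. In K4_0 a transfinite
  family is a family indexed by the field of a non-empty well-order. HOL cannot quantify over the
  type of the indices inside a formula; indices are taken from the type of subsets of the space,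
  which is no restriction: only the range of the family matters, and the range is itself
  well-ordered by inclusion. Lemma \<open>weak_kappa_metric_INF\<close> below gives K4_0 for all index types.
\<close>

definition weak_kappa_metric :: "'a topology \<Rightarrow> ('a \<Rightarrow> 'a set \<Rightarrow> real) \<Rightarrow> bool" where
  "weak_kappa_metric X d \<longleftrightarrow>
     (\<forall>x\<in>topspace X. \<forall>C. regularly_closedin X C \<longrightarrow> 0 \<le> d x C) \<and>
     (\<forall>C. regularly_closedin X C \<longrightarrow>
        (\<exists>V. openin (subtopology X (topspace X - C)) V \<and>
             (subtopology X (topspace X - C)) closure_of V = topspace X - C \<and>
             (\<forall>x\<in>topspace X. 0 < d x C \<longleftrightarrow> x \<in> V))) \<and>
     (\<forall>C C'. regularly_closedin X C \<and> regularly_closedin X C' \<and> C \<subseteq> C' \<longrightarrow>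
        (\<forall>x\<in>topspace X. d x C' \<le> d x C)) \<and>
     (\<forall>C. regularly_closedin X C \<longrightarrow> continuous_map X euclideanreal (\<lambda>x. d x C)) \<and>
     (\<forall>(r :: 'a set rel) C.
        Well_order r \<and> Field r \<noteq> {} \<and> (\<forall>i\<in>Field r. regularly_closedin X (C i)) \<and>
        (\<forall>i j. (i, j) \<in> r \<longrightarrow> C i \<subseteq> C j) \<longrightarrow>
        continuous_map X euclideanreal (\<lambda>x. INF i\<in>Field r. d x (C i)))"

definition weakly_kappa_metrizable :: "'a topology \<Rightarrow> bool" where
  "weakly_kappa_metrizable X \<longleftrightarrow> (\<exists>d. weak_kappa_metric X d)"

lemma weak_kappa_metric_INF:
  fixes X :: "'a topology" and r :: "'j rel"
  assumes d: "weak_kappa_metric X d"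
    and r: "Well_order r" "Field r \<noteq> {}"
    and C: "\<And>i. i \<in> Field r \<Longrightarrow> regularly_closedin X (C i)"
    and incr: "\<And>i j. (i, j) \<in> r \<Longrightarrow> C i \<subseteq> C j"
  shows "continuous_map X euclideanreal (\<lambda>x. INF i\<in>Field r. d x (C i))"
proof -
  define s where "s = {(D, E). D \<in> C ` Field r \<and> E \<in> C ` Field r \<and> D \<subseteq> E}"
  have Fs: "Field s = C ` Field r"
    by (auto simp: s_def Field_def)
  have tot: "(i, j) \<in> r \<or> (j, i) \<in> r" if "i \<in> Field r" "j \<in> Field r" for i j
    using r(1) that unfolding order_on_defs refl_on_def total_on_def by (cases "i = j") blast+
  have wf: "wf (r - Id)"
    using r(1) by (simp add: well_order_on_def)
  have "wf (s - Id)"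
    unfolding wf_eq_minimal
  proof (intro allI impI)
    fix Q and D :: "'a set" assume D: "D \<in> Q"
    show "\<exists>z\<in>Q. \<forall>y. (y, z) \<in> s - Id \<longrightarrow> y \<notin> Q"
    proof (cases "Q \<inter> C ` Field r = {}")
      case True
      then show ?thesis using D by (auto simp: s_def)
    next
      case False
      then obtain i where "i \<in> {i \<in> Field r. C i \<in> Q}" by auto
      then obtain m where m: "m \<in> {i \<in> Field r. C i \<in> Q}"
        and mmin: "\<And>y. (y, m) \<in> r - Id \<Longrightarrow> y \<notin> {i \<in> Field r. C i \<in> Q}"
        by (rule wfE_min[OF wf]) blast
      have "y \<notin> Q" if y: "(y, C m) \<in> s - Id" for y
      proof
        assume "y \<in> Q"
        then obtain k where k: "k \<in> Field r" "y = C k" "C k \<in> Q"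
          using y by (auto simp: s_def)
        then have "(k, m) \<notin> r - Id" using mmin by blast
        then have "(m, k) \<in> r" using tot[OF k(1), of m] m y k by auto
        then have "C m \<subseteq> C k" by (rule incr)
        then show False using y k by (auto simp: s_def)
      qed
      then show ?thesis using m by blast
    qed
  qed
  moreover have "linear_order_on (Field s) s"
  proof -
    have "D \<subseteq> E \<or> E \<subseteq> D" if "D \<in> C ` Field r" "E \<in> C ` Field r" for D E
      using that tot incr by blast
    then show ?thesis
      unfolding Fs
      by (auto simp: s_def order_on_defs refl_on_def total_on_def trans_def antisym_def)
  qed
  ultimately have "Well_order s"
    by (simp add: well_order_on_def)
  moreover have "Field s \<noteq> {}" "\<forall>D\<in>Field s. regularly_closedin X (id D)"
    "\<forall>D E. (D, E) \<in> s \<longrightarrow> id D \<subseteq> id E"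
    using r C unfolding Fs by (auto simp: s_def)
  ultimately have "continuous_map X euclideanreal (\<lambda>x. INF D\<in>Field s. d x (id D))"
    using d unfolding weak_kappa_metric_def by blast
  then show ?thesis
    by (simp add: Fs image_image)
qed

section \<open>Skeletally generated spaces\<close>

definition skeletal_map :: "'a topology \<Rightarrow> 'b topology \<Rightarrow> ('a \<Rightarrow> 'b) \<Rightarrow> bool" where
  "skeletal_map X Y f \<longleftrightarrow> continuous_map X Y f \<and>
     (\<forall>U. openin X U \<and> U \<noteq> {} \<longrightarrow> Y interior_of (Y closure_of (f ` U)) \<noteq> {})"

text \<open>
  \<open>(a, b) \<in> r\<close> means that \<open>a\<close> is below \<open>b\<close>. Antisymmetry is not required of a directed set, so
  suprema need not be unique and supremum is a relation.
\<close>

definition directed_set :: "'i set \<Rightarrow> 'i rel \<Rightarrow> bool" where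
  "directed_set A r \<longleftrightarrow> A \<noteq> {} \<and> preorder_on A r \<and>
     (\<forall>a\<in>A. \<forall>b\<in>A. \<exists>c\<in>A. (a, c) \<in> r \<and> (b, c) \<in> r)"

definition is_supremum :: "'i set \<Rightarrow> 'i rel \<Rightarrow> 'i set \<Rightarrow> 'i \<Rightarrow> bool" where
  "is_supremum A r S b \<longleftrightarrow> b \<in> A \<and> (\<forall>a\<in>S. (a, b) \<in> r) \<and>
     (\<forall>u\<in>A. (\<forall>a\<in>S. (a, u) \<in> r) \<longrightarrow> (b, u) \<in> r)"

definition sigma_complete :: "'i set \<Rightarrow> 'i rel \<Rightarrow> bool" where
  "sigma_complete A r \<longleftrightarrow>
     (\<forall>S. S \<subseteq> A \<and> S \<noteq> {} \<and> countable S \<and> total_on S r \<longrightarrow> (\<exists>b. is_supremum A r S b))"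

text \<open>The bonding map from \<open>Xs b\<close> to \<open>Xs a\<close>, for \<open>a\<close> below \<open>b\<close>, is \<open>p b a\<close>.\<close>

definition inverse_system ::
  "'i set \<Rightarrow> 'i rel \<Rightarrow> ('i \<Rightarrow> 'b topology) \<Rightarrow> ('i \<Rightarrow> 'i \<Rightarrow> 'b \<Rightarrow> 'b) \<Rightarrow> bool" where
  "inverse_system A r Xs p \<longleftrightarrow> directed_set A r \<and>
     (\<forall>a b. (a, b) \<in> r \<longrightarrow> continuous_map (Xs b) (Xs a) (p b a)) \<and>
     (\<forall>a\<in>A. \<forall>x\<in>topspace (Xs a). p a a x = x) \<and>
     (\<forall>a b c. (a, b) \<in> r \<and> (b, c) \<in> r \<longrightarrow>
        (\<forall>x\<in>topspace (Xs c). p b a (p c b x) = p c a x))"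

definition inverse_limit ::
  "'i set \<Rightarrow> 'i rel \<Rightarrow> ('i \<Rightarrow> 'b topology) \<Rightarrow> ('i \<Rightarrow> 'i \<Rightarrow> 'b \<Rightarrow> 'b) \<Rightarrow> ('i \<Rightarrow> 'b) topology" where
  "inverse_limit A r Xs p =
     subtopology (product_topology Xs A) {x. \<forall>a b. (a, b) \<in> r \<longrightarrow> p b a (x b) = x a}"

text \<open>
  In the second-last clause \<open>s n\<close> is an increasing sequence with supremum \<open>b\<close>, and the limit is that
  of the inverse sequence of the spaces \<open>Xs (s n)\<close>. The last clause represents the space as a
  subspace of the limit by an embedding \<open>e\<close>, whose image the limit projections map onto
  the spaces \<open>Xs a\<close>.
\<close>

definition skeletally_generating ::
  "'a topology \<Rightarrow> 'i set \<Rightarrow> 'i rel \<Rightarrow> ('i \<Rightarrow> 'b topology) \<Rightarrow> ('i \<Rightarrow> 'i \<Rightarrow> 'b \<Rightarrow> 'b) \<Rightarrow> bool" where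
  "skeletally_generating X A r Xs p \<longleftrightarrow>
     inverse_system A r Xs p \<and>
     (\<forall>a\<in>A. metrizable_space (Xs a) \<and> separable_space (Xs a)) \<and>
     (\<forall>a b. (a, b) \<in> r \<longrightarrow>
        skeletal_map (Xs b) (Xs a) (p b a) \<and> p b a ` topspace (Xs b) = topspace (Xs a)) \<and>
     sigma_complete A r \<and>
     (\<forall>s b. (\<forall>n::nat. s n \<in> A \<and> (s n, s (Suc n)) \<in> r) \<and> is_supremum A r (range s) b \<longrightarrow>
        (let L = inverse_limit UNIV {(m, n). m \<le> n} (\<lambda>n. Xs (s n)) (\<lambda>n m. p (s n) (s m));
             h = (\<lambda>x n. p b (s n) x)
         in embedding_map (Xs b) L h \<and> L closure_of (h ` topspace (Xs b)) = topspace L)) \<and>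
     (\<exists>e. embedding_map X (inverse_limit A r Xs p) e \<and>
          (\<forall>a\<in>A. (\<lambda>x. e x a) ` topspace X = topspace (Xs a)))"

text \<open>
  The types of the indices and of the points of the spaces in the system are parameters, since HOL
  cannot quantify over them existentially. A theorem that assumes this property with free type
  variables covers all index sets and all systems of spaces.
\<close>

definition skeletally_generated :: "'i itself \<Rightarrow> 'b itself \<Rightarrow> 'a topology \<Rightarrow> bool" where
  "skeletally_generated TI TB X \<longleftrightarrow>
     (\<exists>(A :: 'i set) r (Xs :: 'i \<Rightarrow> 'b topology) p. skeletally_generating X A r Xs p)"

end

theory Submission
  imports Defs
begin

text \<open>
  A map is skeletal onto its image when every non-empty open set of the domain is dense over some
  non-empty open set of the image. For a set \<open>I\<close> of indices closed under upper bounds, the topology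
  on \<open>X\<close> generated by the projections \<open>X \<rightarrow> X\<^sub>a\<close>, \<open>a \<in> I\<close>, lies skeletally below the topology of
  \<open>X\<close>: a counterexample would already live on a countable subset of \<open>I\<close>, hence on one space
  \<open>X\<^sub>b\<close>, by sigma-completeness, contradicting skeletality of the bonding maps. Well-ordering an
  index set by its cardinality and inducting on the cardinality then yields a family of cozero sets
  of \<open>X\<close>, the letters, with an orthogonality relation on them, such that disjoint open sets of \<open>X\<close>
  contain orthogonal finite boxes of letters densely. So \<open>X\<close> behaves like a space that is
  pi-regularly embedded in a product of second countable spaces.

  As on a product, the distance from \<open>x\<close> to \<open>C\<close> is the supremum of the weights at \<open>x\<close> of all boxes
  orthogonal to every box inside \<open>C\<close>. Each letter is orthogonal to only finitely many letters of
  bounded weight, so of the boxes of bounded weight orthogonal to a given family only finitely many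
  are minimal. This makes the distance continuous, and makes the infimum along an increasing
  family of closed sets the distance to a union.
\<close>

section \<open>Distances from orthogonal boxes\<close>

text \<open>A part of greatest size common to many boxes starts both compactness arguments
  below.\<close>

lemma ex_max_card:
  assumes "P {}" "\<And>t. P t \<Longrightarrow> card t \<le> n"
  shows "\<exists>t. P t \<and> (\<forall>u. P u \<longrightarrow> card u \<le> card t)"
  by (rule ex_has_greatest_nat[where b = "Suc n"]) (use assms in \<open>auto simp: less_Suc_eq_le\<close>)

lemma chain_finite_upper:
  assumes "finite B" "B \<subseteq> K" "K \<noteq> {}"
    and "\<And>i j. i \<in> K \<Longrightarrow> j \<in> K \<Longrightarrow> E i \<subseteq> E j \<or> E j \<subseteq> E i"
  shows "\<exists>i\<in>K. \<forall>j\<in>B. E j \<subseteq> E i"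
  using assms(1,2)
proof (induction B rule: finite_induct)
  case (insert k B)
  then obtain i where i: "i \<in> K" "\<forall>j\<in>B. E j \<subseteq> E i" "k \<in> K" by blast
  then show ?case using assms(4)[of i k] by blast
qed (use assms(3) in blast)

text \<open>Infinitely many letters may share a weight; \<open>orth_fin\<close> leaves only finitely
  many of them orthogonal to a given letter, which is the source of compactness. The bound
  \<open>h_le\<close> lets boxes of large total weight be neglected.\<close>

locale letter_system =
  fixes X :: "'a topology" and h :: "'l \<Rightarrow> 'a \<Rightarrow> real" and w :: "'l \<Rightarrow> nat"
    and orth :: "'l \<Rightarrow> 'l \<Rightarrow> bool"
  assumes h_cont: "continuous_map X euclideanreal (h l)"
    and h_nonneg: "0 \<le> h l x"
    and h_le: "h l x \<le> (1/2) ^ w l"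
    and w_pos: "0 < w l"
    and orth_fin: "finite {l. w l \<le> n \<and> orth l l'}"
begin

text \<open>As in a product, one separating coordinate makes two boxes disjoint. Finiteness of
  \<open>s\<close> is built in because a product over an infinite set defaults to 1.\<close>

definition perp :: "'l set set \<Rightarrow> 'l set \<Rightarrow> bool" where
  "perp E s \<longleftrightarrow> finite s \<and> (\<forall>b\<in>E. \<exists>l\<in>s. \<exists>l'\<in>b. orth l l')"

definition box_fun :: "'l set \<Rightarrow> 'a \<Rightarrow> real" where
  "box_fun s x = (\<Prod>l\<in>s. h l x)"

text \<open>The inserted 0 makes the supremum 0 when no box is orthogonal to
  \<open>E\<close>.\<close>

definition gap :: "'l set set \<Rightarrow> 'a \<Rightarrow> real" where
  "gap E x = Sup (insert 0 {box_fun s x |s. perp E s})"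

lemma h_le_1: "h l x \<le> 1"
  using h_le[of l x] power_le_one[of "1/2::real" "w l"] by simp

lemma box_fun_nonneg: "0 \<le> box_fun s x"
  unfolding box_fun_def by (intro prod_nonneg) (simp add: h_nonneg)

lemma box_fun_antimono:
  assumes "finite s" "t \<subseteq> s" shows "box_fun s x \<le> box_fun t x"
proof -
  have "box_fun s x = box_fun t x * box_fun (s - t) x"
    using assms unfolding box_fun_def by (simp add: prod.subset_diff mult.commute)
  moreover have "box_fun (s - t) x \<le> 1"
    unfolding box_fun_def by (intro prod_le_1) (simp add: h_nonneg h_le_1)
  ultimately show ?thesis
    using mult_left_le[OF _ box_fun_nonneg] by metis
qed

text \<open>A lower bound on the value of a box thus bounds its total weight and, weights being
  positive, its size.\<close>

lemma box_fun_le: "box_fun s x \<le> (1/2) ^ sum w s"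
  unfolding box_fun_def power_sum by (intro prod_mono) (simp add: h_nonneg h_le)

lemma box_fun_le_1: "box_fun s x \<le> 1"
  unfolding box_fun_def by (intro prod_le_1) (simp add: h_nonneg h_le_1)

lemma box_fun_cont: "continuous_map X euclideanreal (box_fun s)"
proof (cases "finite s")
  case True
  then show ?thesis unfolding box_fun_def by (intro continuous_map_prod h_cont)
qed (simp add: box_fun_def[abs_def])

lemma box_fun_pos: "finite s \<Longrightarrow> 0 < box_fun s x \<longleftrightarrow> (\<forall>l\<in>s. 0 < h l x)"
  by (induction s rule: finite_induct)
    (auto simp: box_fun_def zero_less_mult_iff less_le h_nonneg prod_nonneg)

lemma bdd_gap: "bdd_above (insert 0 {box_fun s x |s. perp E s})"
  by (rule bdd_aboveI[of _ 1]) (auto simp: box_fun_le_1)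

lemma gap_nonneg: "0 \<le> gap E x"
  unfolding gap_def by (intro cSup_upper bdd_gap) simp

lemma gap_upper: "perp E s \<Longrightarrow> box_fun s x \<le> gap E x"
  unfolding gap_def by (intro cSup_upper bdd_gap) auto

lemma less_gap_iff: "0 \<le> q \<Longrightarrow> q < gap E x \<longleftrightarrow> (\<exists>s. perp E s \<and> q < box_fun s x)"
  unfolding gap_def by (subst less_cSup_iff[OF _ bdd_gap]) auto

lemma gap_antimono: "E \<subseteq> F \<Longrightarrow> gap F x \<le> gap E x"
  unfolding gap_def
  by (intro cSup_subset_mono bdd_gap) (blast, unfold perp_def, blast)

lemma w_le_sum: "finite s \<Longrightarrow> l \<in> s \<Longrightarrow> w l \<le> sum w s"
  by (simp add: member_le_sum)

lemma card_le_sum: "finite s \<Longrightarrow> card s \<le> sum w s"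
  using sum_mono[of s "\<lambda>_. 1" w] w_pos by (auto simp: Suc_le_eq)

lemma finite_orth: "finite b \<Longrightarrow> finite {l. w l \<le> n \<and> (\<exists>l'\<in>b. orth l l')}"
  by (rule finite_subset[of _ "\<Union>l'\<in>b. {l. w l \<le> n \<and> orth l l'}"]) (auto simp: orth_fin)

section \<open>Minimal orthogonal boxes and continuity of \<open>gap\<close>\<close>

text \<open>
  If there were infinitely many minimal sets, take \<open>t\<close> of maximal size contained in infinitely many
  of them. A box \<open>b\<close> meets orthogonally only finitely many letters outside \<open>t\<close>, each in finitely many
  of these sets, so \<open>t\<close> itself is orthogonal to \<open>b\<close>, against minimality.
\<close>

lemma finite_minimal_perp:
  assumes E: "\<And>b. b \<in> E \<Longrightarrow> finite b"
  shows "finite {s. perp E s \<and> sum w s \<le> n \<and> (\<forall>t. t \<subset> s \<longrightarrow> \<not> perp E t)}"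
proof (rule ccontr)
  define M where "M = {s. perp E s \<and> sum w s \<le> n \<and> (\<forall>t. t \<subset> s \<longrightarrow> \<not> perp E t)}"
  assume "\<not> ?thesis"
  then have inf: "infinite M" by (simp add: M_def)
  let ?Q = "\<lambda>t. infinite {s \<in> M. t \<subseteq> s}"
  have bound: "finite t \<and> card t \<le> n" if Qt: "?Q t" for t
  proof -
    obtain s where s: "s \<in> M" "t \<subseteq> s"
      using infinite_imp_nonempty[OF Qt] by blast
    then have "finite s" "sum w s \<le> n" by (auto simp: perp_def M_def)
    then show ?thesis
      using s card_mono[of s t] card_le_sum[of s] finite_subset by fastforce
  qed
  have "?Q {}" using inf by simp
  then obtain t where t: "?Q t" and tmax: "\<And>u. ?Q u \<Longrightarrow> card u \<le> card t"
    using ex_max_card[of ?Q n] bound by blast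
  have fint: "finite t" using bound t by blast
  have fin: "finite {s \<in> M. insert l t \<subseteq> s}" if "l \<notin> t" for l
    using tmax[of "insert l t"] that fint by fastforce
  have "perp E t"
    unfolding perp_def
  proof (intro conjI ballI)
    fix b assume b: "b \<in> E"
    define B where "B = {l. w l \<le> n \<and> (\<exists>l'\<in>b. orth l l')} - t"
    have "infinite ({s \<in> M. t \<subseteq> s} - (\<Union>l\<in>B. {s \<in> M. insert l t \<subseteq> s}))"
      using finite_orth[OF E[OF b]] fin
      by (intro Diff_infinite_finite[OF _ t] finite_UN_I) (auto simp: B_def)
    then obtain s where s: "s \<in> M" "t \<subseteq> s" "s \<notin> (\<Union>l\<in>B. {s \<in> M. insert l t \<subseteq> s})"
      using infinite_imp_nonempty by blast
    then obtain l l' where l: "l \<in> s" "l' \<in> b" "orth l l'"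
      using b by (auto simp: perp_def M_def)
    then have "w l \<le> n" using s w_le_sum[of s l] by (fastforce simp: perp_def M_def)
    then show "\<exists>l\<in>t. \<exists>l'\<in>b. orth l l'"
      using l s by (auto simp: B_def)
  qed (rule fint)
  then have "{s \<in> M. t \<subseteq> s} \<subseteq> {t}" by (auto simp: M_def)
  then show False using t finite_subset by blast
qed

lemma minimal_perp_subset:
  assumes "perp E s"
  shows "\<exists>t\<subseteq>s. perp E t \<and> (\<forall>u. u \<subset> t \<longrightarrow> \<not> perp E u)"
proof -
  have "finite {t. t \<subseteq> s \<and> perp E t}" using assms by (simp add: perp_def)
  from finite_has_minimal2[OF this, of s] assms obtain t where
    t: "t \<subseteq> s" "perp E t" "\<forall>u\<in>{t. t \<subseteq> s \<and> perp E t}. u \<subseteq> t \<longrightarrow> t = u" by auto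
  then show ?thesis by (intro exI[of _ t]) blast
qed

text \<open>A supremum of continuous functions is lower semicontinuous. For upper semicontinuity at
  \<open>q > 0\<close>, any box of value above \<open>q / 2\<close> has bounded weight and shrinks
  to a minimal box of no smaller value; these are finitely many.\<close>

lemma gap_continuous:
  assumes E: "\<And>b. b \<in> E \<Longrightarrow> finite b"
  shows "continuous_map X euclideanreal (gap E)"
  unfolding continuous_map_upper_lower_semicontinuous_lt
proof (intro conjI allI)
  fix q :: real
  have box_open: "openin X {x \<in> topspace X. q < box_fun s x}"
      "openin X {x \<in> topspace X. box_fun s x < q}" for s
    using box_fun_cont[of s] unfolding continuous_map_upper_lower_semicontinuous_lt by blast+
  show "openin X {x \<in> topspace X. q < gap E x}"
  proof (cases "0 \<le> q")
    case True
    have "{x \<in> topspace X. q < gap E x} =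
        \<Union>((\<lambda>s. {x \<in> topspace X. q < box_fun s x}) ` {s. perp E s})"
      using less_gap_iff[OF True] by auto
    then show ?thesis using box_open(1) by auto
  next
    case False
    then have "q < gap E x" for x using gap_nonneg[of E x] by linarith
    then have "{x \<in> topspace X. q < gap E x} = topspace X" by auto
    then show ?thesis by simp
  qed
  show "openin X {x \<in> topspace X. gap E x < q}"
  proof (cases "0 < q")
    case True
    then obtain n where n: "(1/2) ^ n < q / 2"
      using real_arch_pow_inv[of "q/2" "1/2"] by auto
    define M where "M = {s. perp E s \<and> sum w s \<le> n \<and> (\<forall>t. t \<subset> s \<longrightarrow> \<not> perp E t)}"
    have finM: "finite M" unfolding M_def by (rule finite_minimal_perp[OF E])
    have "gap E x < q \<longleftrightarrow> (\<forall>s\<in>M. box_fun s x < q)" for x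
    proof
      assume "gap E x < q"
      then show "\<forall>s\<in>M. box_fun s x < q"
        using gap_upper[of E _ x] by (fastforce simp: M_def)
    next
      assume M: "\<forall>s\<in>M. box_fun s x < q"
      \<comment> \<open>Including \<open>q / 2\<close> forces every box of value above
        \<open>m\<close> to have total weight at most \<open>n\<close>, so its minimal part belongs
        to \<open>M\<close>.\<close>
      define m where "m = Max (insert (q / 2) ((\<lambda>s. box_fun s x) ` M))"
      have "m < q" using M finM True by (auto simp: m_def)
      moreover have "gap E x \<le> m"
      proof (rule ccontr)
        assume "\<not> gap E x \<le> m"
        moreover have m: "q / 2 \<le> m"
          unfolding m_def using finM by (intro Max_ge) auto
        ultimately obtain s where s: "perp E s" "m < box_fun s x"
          using less_gap_iff[of m E x] True by auto
        obtain t where t: "t \<subseteq> s" "perp E t" "\<forall>u. u \<subset> t \<longrightarrow> \<not> perp E u"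
          using minimal_perp_subset[OF s(1)] by blast
        have mt: "m < box_fun t x"
          using s t(1) box_fun_antimono[of s t x] by (auto simp: perp_def)
        have "(1/2::real) ^ n < (1/2) ^ sum w t"
          using box_fun_le[of t x] mt m n by linarith
        then have "sum w t \<le> n"
          using power_decreasing[of n "sum w t" "1/2::real"] by fastforce
        then have "t \<in> M" using t by (auto simp: M_def)
        then have "box_fun t x \<le> m" unfolding m_def using finM by (intro Max_ge) auto
        then show False using mt by simp
      qed
      ultimately show "gap E x < q" by simp
    qed
    then have "{x \<in> topspace X. gap E x < q} =
        topspace X \<inter> \<Inter>((\<lambda>s. {x \<in> topspace X. box_fun s x < q}) ` M)" by auto
    moreover have "openin X (topspace X \<inter> \<Inter>((\<lambda>s. {x \<in> topspace X. box_fun s x < q}) ` M))"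
      using finM box_open(2) by (cases "M = {}") auto
    ultimately show ?thesis by simp
  next
    case False
    then have "\<not> gap E x < q" for x using gap_nonneg[of E x] by linarith
    then show ?thesis by simp
  qed
qed

text \<open>Take \<open>t\<close> of greatest size that lies in some member of \<open>F i\<close>
  for every \<open>i\<close>. Each letter outside \<open>t\<close> fails to extend it at some index.
  Only finitely many letters of bounded weight are orthogonal to a box \<open>b\<close>, so an index
  above all their failures gives a box that is orthogonal to \<open>b\<close> through a letter of
  \<open>t\<close>.\<close>

lemma perp_Union_chain:
  assumes E: "\<And>i b. i \<in> K \<Longrightarrow> b \<in> E i \<Longrightarrow> finite b" and K: "K \<noteq> {}"
    and chain: "\<And>i j. i \<in> K \<Longrightarrow> j \<in> K \<Longrightarrow> E i \<subseteq> E j \<or> E j \<subseteq> E i"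
    and q: "0 < q" and big: "\<And>i. i \<in> K \<Longrightarrow> \<exists>s. perp (E i) s \<and> q < box_fun s x"
  shows "\<exists>s. perp (\<Union>i\<in>K. E i) s \<and> q < box_fun s x"
proof -
  obtain n where n: "(1/2) ^ n < q"
    using real_arch_pow_inv[OF q, of "1/2"] by auto
  have sum_le: "sum w s \<le> n" if "q < box_fun s x" for s
  proof -
    have "(1/2::real) ^ n < (1/2) ^ sum w s"
      using box_fun_le[of s x] that n by linarith
    then show ?thesis using power_decreasing[of n "sum w s" "1/2::real"] by fastforce
  qed
  define F where "F i = {s. perp (E i) s \<and> q < box_fun s x}" for i
  let ?Q = "\<lambda>t. \<forall>i\<in>K. \<exists>s\<in>F i. t \<subseteq> s"
  have bound: "finite t \<and> card t \<le> n" if Qt: "?Q t" for t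
  proof -
    obtain i s where s: "s \<in> F i" "t \<subseteq> s" using Qt K by blast
    then have "finite s" "sum w s \<le> n" using sum_le by (auto simp: perp_def F_def)
    then show ?thesis
      using s card_mono[of s t] card_le_sum[of s] finite_subset by fastforce
  qed
  have "?Q {}" using big by (auto simp: F_def)
  then obtain t where t: "?Q t" and tmax: "\<And>u. ?Q u \<Longrightarrow> card u \<le> card t"
    using ex_max_card[of ?Q n] bound by blast
  have fint: "finite t" using bound t by blast
  have "\<exists>i\<in>K. \<forall>s\<in>F i. \<not> insert l t \<subseteq> s" if "l \<notin> t" for l
    using tmax[of "insert l t"] that fint by fastforce
  then obtain k where k: "\<And>l. l \<notin> t \<Longrightarrow> k l \<in> K \<and> (\<forall>s\<in>F (k l). \<not> insert l t \<subseteq> s)"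
    by metis
  have "perp (\<Union>i\<in>K. E i) t"
    unfolding perp_def
  proof (intro conjI ballI)
    fix b assume "b \<in> (\<Union>i\<in>K. E i)"
    then obtain j where j: "j \<in> K" "b \<in> E j" by blast
    define B where "B = {l. w l \<le> n \<and> (\<exists>l'\<in>b. orth l l')} - t"
    have "finite (insert j (k ` B))" "insert j (k ` B) \<subseteq> K"
      using finite_orth[OF E[OF j]] j k by (auto simp: B_def)
    then obtain i where iK: "i \<in> K" and top: "\<And>i'. i' \<in> insert j (k ` B) \<Longrightarrow> E i' \<subseteq> E i"
      using chain_finite_upper[of "insert j (k ` B)" K E] K chain by blast
    obtain s where s: "s \<in> F i" "t \<subseteq> s" using t iK by blast
    have perp: "perp (E i) s" and big: "q < box_fun s x" using s by (simp_all add: F_def)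
    have "b \<in> E i" using top[of j] j by blast
    then obtain l l' where l: "l \<in> s" "l' \<in> b" "orth l l'"
      using perp unfolding perp_def by blast
    have "finite s" using perp by (simp add: perp_def)
    then have "w l \<le> n" using sum_le[OF big] w_le_sum[of s l] l by simp
    moreover have "l \<notin> B"
    proof
      assume lB: "l \<in> B"
      \<comment> \<open>The families \<open>F\<close> shrink as \<open>E\<close> grows, so the
        failure at \<open>k l\<close> persists at \<open>i\<close>.\<close>
      then have "E (k l) \<subseteq> E i" using top by blast
      then have "s \<in> F (k l)" using perp big by (auto simp: F_def perp_def)
      moreover have "l \<notin> t" using lB by (simp add: B_def)
      ultimately show False using k[of l] l s by blast
    qed
    ultimately show "\<exists>l\<in>t. \<exists>l'\<in>b. orth l l'" using l by (auto simp: B_def)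
  qed (rule fint)
  moreover obtain i s where "i \<in> K" "s \<in> F i" "t \<subseteq> s" using t K by blast
  then have "q < box_fun t x"
    using box_fun_antimono[of s t x] by (auto simp: F_def perp_def)
  ultimately show ?thesis by blast
qed

lemma INF_gap_chain:
  assumes E: "\<And>i b. i \<in> K \<Longrightarrow> b \<in> E i \<Longrightarrow> finite b" and K: "K \<noteq> {}"
    and chain: "\<And>i j. i \<in> K \<Longrightarrow> j \<in> K \<Longrightarrow> E i \<subseteq> E j \<or> E j \<subseteq> E i"
  shows "(INF i\<in>K. gap (E i) x) = gap (\<Union>i\<in>K. E i) x"
proof (rule antisym)
  show "gap (\<Union>i\<in>K. E i) x \<le> (INF i\<in>K. gap (E i) x)"
    by (intro cINF_greatest K gap_antimono) blast
  show "(INF i\<in>K. gap (E i) x) \<le> gap (\<Union>i\<in>K. E i) x"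
  proof (rule ccontr)
    assume "\<not> ?thesis"
    then obtain q where q: "gap (\<Union>i\<in>K. E i) x < q" "q < (INF i\<in>K. gap (E i) x)"
      using dense not_le by metis
    have q0: "0 < q" using q(1) gap_nonneg by (rule le_less_trans[rotated])
    have "bdd_below ((\<lambda>i. gap (E i) x) ` K)"
      by (rule bdd_belowI[of _ 0]) (auto simp: gap_nonneg)
    then have "q < gap (E i) x" if "i \<in> K" for i
      using q(2) cINF_lower[of "\<lambda>i. gap (E i) x" K i] that by linarith
    then have big: "\<exists>s. perp (E i) s \<and> q < box_fun s x" if "i \<in> K" for i
      using that less_gap_iff[of q] q0 by auto
    have "\<exists>s. perp (\<Union>i\<in>K. E i) s \<and> q < box_fun s x"
      by (rule perp_Union_chain[OF _ K _ q0]) (use E chain big in blast)+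
    then obtain s where
      "perp (\<Union>i\<in>K. E i) s" "q < box_fun s x" by blast
    then show False using gap_upper[of "\<Union>i\<in>K. E i" s x] q by linarith
  qed
qed

definition coz :: "'l set \<Rightarrow> 'a set" where
  "coz b = {x \<in> topspace X. \<forall>l\<in>b. 0 < h l x}"

lemma openin_coz: assumes "finite b" shows "openin X (coz b)"
proof -
  have "coz b = {x \<in> topspace X. 0 < box_fun b x}"
    using box_fun_pos[OF assms] by (auto simp: coz_def)
  then show ?thesis
    using box_fun_cont[of b] by (simp add: continuous_map_upper_lower_semicontinuous_lt)
qed

end

section \<open>From a frame to a weak kappa-metric\<close>

text \<open>
  \<open>op\<close> is the family of open sets of a topology coarser than that of \<open>X\<close>. In a pair \<open>good b W\<close> the
  box \<open>b\<close> is a formal product of letters assigned to the open set \<open>W\<close>; the actual set \<open>coz b\<close> need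
  not lie in \<open>W\<close>, and \<open>disj\<close> replaces disjointness of the formal products.
\<close>

locale frame = letter_system X h w orth
  for X :: "'a topology" and h :: "'l \<Rightarrow> 'a \<Rightarrow> real" and w and orth +
  fixes op :: "'a set \<Rightarrow> bool" and good :: "'l set \<Rightarrow> 'a set \<Rightarrow> bool"
  assumes op_coz: "op {x \<in> topspace X. 0 < h l x}"
    and orth: "orth l l' \<Longrightarrow> x \<in> topspace X \<Longrightarrow> h l x = 0 \<or> h l' x = 0"
    and good: "good b W \<Longrightarrow> finite b \<and> op W"
    and dense: "op G \<Longrightarrow> G \<noteq> {} \<Longrightarrow> \<exists>b W. good b W \<and> W \<subseteq> G \<and> W \<inter> coz b \<noteq> {}"
    and disj: "good b W \<Longrightarrow> good b' W' \<Longrightarrow> W \<inter> W' = {} \<Longrightarrow> \<exists>l\<in>b. \<exists>l'\<in>b'. orth l l'"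
begin

lemma weakly_kappa_metrizable:
  assumes op: "op = openin X"
  shows "weakly_kappa_metrizable X"
proof -
  \<comment> \<open>Containment in \<open>C\<close> is tested on \<open>W\<close>, since
    \<open>coz b\<close> may reach outside \<open>W\<close>.\<close>
  define E where "E C = {b. \<exists>W. good b W \<and> W \<subseteq> C}" for C
  have finE: "\<And>C b. b \<in> E C \<Longrightarrow> finite b" using good by (auto simp: E_def)
  have monoE: "E C \<subseteq> E D" if "C \<subseteq> D" for C D using that by (auto simp: E_def)
  define d where "d x C = gap (E C) x" for x C
  have pos: "0 < d x C \<longleftrightarrow> (\<exists>s. perp (E C) s \<and> x \<in> coz s)" if "x \<in> topspace X" for x C
    unfolding d_def less_gap_iff[OF order_refl] using that box_fun_pos
    by (auto simp: perp_def coz_def)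
  have "weak_kappa_metric X d"
    unfolding weak_kappa_metric_def
  proof (intro conjI allI impI ballI)
    fix x C show "0 \<le> d x C" by (simp add: d_def gap_nonneg)
  next
    fix C assume "regularly_closedin X C"
    then obtain U where U: "openin X U" "C = X closure_of U"
      by (auto simp: regularly_closedin_def)
    define V where "V = {x \<in> topspace X. 0 < d x C}"
    have oV: "openin X V"
      using gap_continuous[of "E C"] finE[of _ C]
      by (simp add: V_def d_def continuous_map_upper_lower_semicontinuous_lt)
    have disjV: "V \<inter> C = {}"
    proof (rule ccontr)
      assume "V \<inter> C \<noteq> {}"
      then obtain x s where s: "perp (E C) s" "x \<in> coz s" "x \<in> C"
        using pos by (auto simp: V_def)
      have os: "openin X (coz s)" using s openin_coz by (simp add: perp_def)
      \<comment> \<open>The open set \<open>coz s\<close> meets the closure of \<open>U\<close>,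
        hence \<open>U\<close>. A good pair inside the intersection has a box orthogonal to
        \<open>s\<close> that nevertheless has a point in common with \<open>coz s\<close>.\<close>
      have "coz s \<inter> U \<noteq> {}" using s U os by (auto simp: in_closure_of)
      then obtain b W where b: "good b W" "W \<subseteq> coz s \<inter> U" "W \<inter> coz b \<noteq> {}"
        using dense[of "coz s \<inter> U", unfolded op] os U(1) by blast
      have "U \<subseteq> C" using U(1) by (simp add: U(2) closure_of_subset openin_subset)
      then have "b \<in> E C" using b unfolding E_def by blast
      then obtain l l' where "l \<in> s" "l' \<in> b" "orth l l'" using s by (auto simp: perp_def)
      then show False using b orth[of l l'] by (fastforce simp: coz_def)
    qed
    have sub: "V \<subseteq> topspace X - C" using disjV by (auto simp: V_def)
    show "\<exists>V. openin (subtopology X (topspace X - C)) V \<and>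
             (subtopology X (topspace X - C)) closure_of V = topspace X - C \<and>
             (\<forall>x\<in>topspace X. 0 < d x C \<longleftrightarrow> x \<in> V)"
    proof (intro exI[of _ V] conjI ballI)
      show "openin (subtopology X (topspace X - C)) V"
        using oV sub by (auto simp: openin_subtopology)
      have oC: "openin X (topspace X - C)"
        unfolding U(2) by (intro openin_diff openin_topspace closedin_closure_of)
      have "x \<in> X closure_of V" if x: "x \<in> topspace X - C" for x
        unfolding in_closure_of
      proof (intro conjI allI impI)
        fix T assume T: "x \<in> T \<and> openin X T"
        then have "openin X (T \<inter> (topspace X - C))" "T \<inter> (topspace X - C) \<noteq> {}"
          using x oC by (blast intro: openin_Int)+
        from dense[unfolded op, OF this] obtain b W where
          b: "good b W" "W \<subseteq> T \<inter> (topspace X - C)" "W \<inter> coz b \<noteq> {}" by blast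
        then obtain y where y: "y \<in> W" "y \<in> coz b" by blast
        \<comment> \<open>\<open>W\<close> avoids \<open>C\<close>, hence every open set assigned to
          a box of \<open>E C\<close>; by \<open>disj\<close> the box \<open>b\<close> itself
          witnesses a positive distance at \<open>y\<close>.\<close>
        have "perp (E C) b"
          unfolding perp_def
        proof (intro conjI ballI)
          show "finite b" using good b by blast
          fix b' assume "b' \<in> E C"
          then obtain W' where "good b' W'" "W' \<subseteq> C" by (auto simp: E_def)
          then show "\<exists>l\<in>b. \<exists>l'\<in>b'. orth l l'" using disj[OF b(1)] b(2) by blast
        qed
        then have "y \<in> V" using pos y by (auto simp: V_def coz_def)
        then show "\<exists>y. y \<in> V \<and> y \<in> T" using y b by blast
      qed (use x in blast)
      then show "(subtopology X (topspace X - C)) closure_of V = topspace X - C"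
        using sub by (auto simp: closure_of_subtopology Int_absorb1)
      show "0 < d x C \<longleftrightarrow> x \<in> V" if "x \<in> topspace X" for x using that by (simp add: V_def)
    qed
  next
    fix C C' x
    assume "regularly_closedin X C \<and> regularly_closedin X C' \<and> C \<subseteq> C'"
    then show "d x C' \<le> d x C" by (simp add: d_def gap_antimono monoE)
  next
    fix C show "continuous_map X euclideanreal (\<lambda>x. d x C)"
      using gap_continuous[of "E C"] finE[of _ C] by (simp add: d_def)
  next
    fix r :: "'a set rel" and C :: "'a set \<Rightarrow> 'a set"
    assume r: "Well_order r \<and> Field r \<noteq> {} \<and> (\<forall>i\<in>Field r. regularly_closedin X (C i)) \<and>
        (\<forall>i j. (i, j) \<in> r \<longrightarrow> C i \<subseteq> C j)"
    have "(i, j) \<in> r \<or> (j, i) \<in> r" if "i \<in> Field r" "j \<in> Field r" for i j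
      using r that unfolding order_on_defs refl_on_def total_on_def by (cases "i = j") blast+
    then have "E (C i) \<subseteq> E (C j) \<or> E (C j) \<subseteq> E (C i)" if "i \<in> Field r" "j \<in> Field r" for i j
      using that r monoE by blast
    then have "(INF i\<in>Field r. d x (C i)) = gap (\<Union>i\<in>Field r. E (C i)) x" for x
      unfolding d_def using r finE by (intro INF_gap_chain) auto
    \<comment> \<open>Continuity of \<open>gap\<close> holds for every family of finite boxes, so
      the union need not be of the form \<open>E C\<close>.\<close>
    moreover have "continuous_map X euclideanreal (gap (\<Union>i\<in>Field r. E (C i)))"
      by (rule gap_continuous) (use finE in blast)
    ultimately show "continuous_map X euclideanreal (\<lambda>x. INF i\<in>Field r. d x (C i))"
      by simp
  qed
  then show ?thesis by (auto simp: weakly_kappa_metrizable_def)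
qed

end

section \<open>Gluing along a well-order\<close>

text \<open>
  \<open>J a\<close> is the topology at level \<open>a\<close>, generated by the indices up to \<open>a\<close>, and \<open>K a\<close> the one
  generated by the indices strictly below \<open>a\<close>. Gluings are iterated: a letter \<open>(l, k)\<close> has weight
  \<open>k + 1\<close>, and the list \<open>l\<close> records the levels of the successive gluings it comes from.
\<close>

locale frame_tower =
  fixes X :: "'a topology" and R :: "'i rel" and J K :: "'i \<Rightarrow> 'a set \<Rightarrow> bool"
    and T :: "'a set \<Rightarrow> bool"
    and hh :: "'i \<Rightarrow> 'i list \<times> nat \<Rightarrow> 'a \<Rightarrow> real"
    and ox :: "'i \<Rightarrow> 'i list \<times> nat \<Rightarrow> 'i list \<times> nat \<Rightarrow> bool"
    and gg :: "'i \<Rightarrow> ('i list \<times> nat) set \<Rightarrow> 'a set \<Rightarrow> bool"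
  assumes R: "Well_order R"
    and frames: "a \<in> Field R \<Longrightarrow> frame X (hh a) (\<lambda>l. Suc (snd l)) (ox a) (J a) (gg a)"
    and J_Int: "a \<in> Field R \<Longrightarrow> J a U \<Longrightarrow> J a V \<Longrightarrow> J a (U \<inter> V)"
    and J_top: "a \<in> Field R \<Longrightarrow> J a (topspace X)"
    and T_empty: "T {}"
    and J_T: "a \<in> Field R \<Longrightarrow> J a U \<Longrightarrow> T U"
    and J_K: "a \<in> underS R a' \<Longrightarrow> J a U \<Longrightarrow> K a' U"
    and K_J: "a \<in> Field R \<Longrightarrow> underS R a \<noteq> {} \<Longrightarrow> K a U \<Longrightarrow> J a U"
    and skeletal: "a \<in> Field R \<Longrightarrow> underS R a \<noteq> {} \<Longrightarrow> J a U \<Longrightarrow> U \<noteq> {} \<Longrightarrow>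
      \<exists>P. K a P \<and> P \<noteq> {} \<and> (\<forall>Q. K a Q \<and> Q \<inter> P \<noteq> {} \<longrightarrow> Q \<inter> U \<noteq> {})"
    and T_base: "T U \<Longrightarrow> U \<noteq> {} \<Longrightarrow> \<exists>a\<in>Field R. \<exists>V. J a V \<and> V \<noteq> {} \<and> V \<subseteq> U"
    and K_base: "a \<in> Field R \<Longrightarrow> underS R a \<noteq> {} \<Longrightarrow> K a U \<Longrightarrow> U \<noteq> {} \<Longrightarrow>
      \<exists>a'\<in>underS R a. \<exists>V. J a' V \<and> V \<noteq> {} \<and> V \<subseteq> U"
begin

text \<open>Prepending the level leaves the type of letters unchanged, so gluing can be repeated
  along an induction.\<close>

definition tag :: "'i \<Rightarrow> ('i list \<times> nat) set \<Rightarrow> ('i list \<times> nat) set" where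
  "tag a b = (\<lambda>(l, k). (a # l, k)) ` b"

text \<open>A list that is empty or starts outside the field of \<open>R\<close> gives a null
  letter, which \<open>tower_orth\<close> leaves orthogonal to nothing.\<close>

definition tower_h :: "'i list \<times> nat \<Rightarrow> 'a \<Rightarrow> real" where
  "tower_h L x = (case fst L of [] \<Rightarrow> 0 | a # l \<Rightarrow> if a \<in> Field R then hh a (l, snd L) x else 0)"

text \<open>Letters of different levels are never orthogonal. This preserves \<open>orth_fin\<close>
  however many levels are glued; disjointness across levels is left to the chains.\<close>

definition tower_orth :: "'i list \<times> nat \<Rightarrow> 'i list \<times> nat \<Rightarrow> bool" where
  "tower_orth L L' \<longleftrightarrow> (\<exists>a\<in>Field R. \<exists>l l'. fst L = a # l \<and> fst L' = a # l' \<and>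
     ox a (l, snd L) (l', snd L'))"

definition level_coz :: "'i \<Rightarrow> ('i list \<times> nat) set \<Rightarrow> 'a set" where
  "level_coz a b = {x \<in> topspace X. \<forall>l\<in>b. 0 < hh a l x}"

definition tower_coz :: "('i list \<times> nat) set \<Rightarrow> 'a set" where
  "tower_coz B = {x \<in> topspace X. \<forall>L\<in>B. 0 < tower_h L x}"

text \<open>
  A chain descends to the least level, which is what makes two chains comparable. In a step from
  level \<open>a'\<close> to level \<open>a\<close>, the new open set is dense over the old one, so an open set of
  a lower level that meets the old one also meets the new one.
\<close>

inductive chain :: "'i \<Rightarrow> ('i list \<times> nat) set \<Rightarrow> 'a set \<Rightarrow> bool" where
  bottom: "a \<in> Field R \<Longrightarrow> underS R a = {} \<Longrightarrow> gg a b W \<Longrightarrow> level_coz a b \<inter> W \<noteq> {} \<Longrightarrow>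
    chain a (tag a b) W"
| extend: "chain a' B W' \<Longrightarrow> a \<in> Field R \<Longrightarrow> a' \<in> underS R a \<Longrightarrow> gg a b W \<Longrightarrow>
    (\<And>Q. K a Q \<Longrightarrow> Q \<inter> W' \<noteq> {} \<Longrightarrow> Q \<inter> (level_coz a b \<inter> W) \<noteq> {}) \<Longrightarrow>
    chain a (B \<union> tag a b) W"

section \<open>Chains of boxes descending through the levels\<close>

lemma level_coz: "a \<in> Field R \<Longrightarrow> letter_system.coz X (hh a) b = level_coz a b"
  using letter_system.coz_def[OF frame.axioms(1)[OF frames]] by (simp add: level_coz_def)

lemma finite_tag: "finite b \<Longrightarrow> finite (tag a b)"
  by (simp add: tag_def)

lemma tower_coz_tag: "a \<in> Field R \<Longrightarrow> tower_coz (tag a b) = level_coz a b"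
  by (auto simp: tower_coz_def level_coz_def tag_def tower_h_def)

lemma tower_coz_Un: "tower_coz (B \<union> C) = tower_coz B \<inter> tower_coz C"
  by (auto simp: tower_coz_def)

lemma J_level_coz: "finite b \<Longrightarrow> a \<in> Field R \<Longrightarrow> J a (level_coz a b)"
proof (induction b rule: finite_induct)
  case empty
  then show ?case by (simp add: level_coz_def J_top)
next
  case (insert l b)
  have "level_coz a (insert l b) = {x \<in> topspace X. 0 < hh a l x} \<inter> level_coz a b"
    by (auto simp: level_coz_def)
  then show ?case using insert frame.op_coz[OF frames] J_Int by simp
qed

lemma goodD: "a \<in> Field R \<Longrightarrow> gg a b W \<Longrightarrow> finite b \<and> J a W"
  using frame.good[OF frames] .

text \<open>The substance is that all letters of \<open>B\<close> are positive at a common point of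
  \<open>W\<close>. The cozero set of the lower part is open strictly below the top level and meets
  \<open>W'\<close>, so by the condition in \<open>extend\<close> it meets the new box within
  \<open>W\<close>.\<close>

lemma chain_props:
  "chain a B W \<Longrightarrow> a \<in> Field R \<and> finite B \<and> J a W \<and> J a (tower_coz B) \<and> W \<inter> tower_coz B \<noteq> {}"
proof (induction rule: chain.induct)
  case (bottom a b W)
  then show ?case
    using goodD[of a b W] J_level_coz[of b a] by (simp add: finite_tag tower_coz_tag Int_commute)
next
  case (extend a' B W' a b W)
  have b: "finite b" "J a W" using goodD extend by blast+
  have K: "K a (tower_coz B)" using extend J_K by blast
  then have "tower_coz B \<inter> (level_coz a b \<inter> W) \<noteq> {}" using extend by blast
  moreover have "J a (tower_coz B \<inter> level_coz a b)"
    using K extend J_level_coz[OF b(1)] K_J J_Int by blast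
  ultimately show ?case
    using extend b by (auto simp: tower_coz_Un tower_coz_tag finite_tag)
qed

lemma chain_top:
  "chain a B W \<Longrightarrow> a \<in> Field R \<and> (\<exists>b. gg a b W \<and> tag a b \<subseteq> B)"
  by (erule chain.cases) blast+

lemma chain_below:
  assumes "chain a B W" "underS R a \<noteq> {}"
  obtains a' B' W' where "chain a' B' W'" "B' \<subseteq> B" "a' \<in> underS R a"
    "\<And>Q. K a Q \<Longrightarrow> Q \<inter> W' \<noteq> {} \<Longrightarrow> Q \<inter> W \<noteq> {}"
  using assms by (cases rule: chain.cases) blast+

lemma wf_R: "wf (R - Id)"
  using R by (simp add: well_order_on_def)

lemma R_trichotomy:
  assumes "a \<in> Field R" "a' \<in> Field R"
  shows "a = a' \<or> a \<in> underS R a' \<or> a' \<in> underS R a"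
  using R assms unfolding order_on_defs total_on_def underS_def by auto

lemma R_induct [consumes 0, case_names less]:
  assumes "\<And>a. (\<And>a'. a' \<in> underS R a \<Longrightarrow> P a') \<Longrightarrow> P a"
  shows "P a"
  by (rule wf_induct_rule[OF wf_R]) (use assms in \<open>auto simp: underS_def\<close>)

text \<open>Double induction on the top levels. At equal levels \<open>disj\<close> of that frame
  applies. Otherwise the open set of the lower chain is open strictly below the higher level; since
  it misses the top open set of the higher chain, it also misses the one before, and the higher
  chain is shortened.\<close>

lemma chain_disj:
  "chain a B W \<Longrightarrow> chain a' B' W' \<Longrightarrow> W \<inter> W' = {} \<Longrightarrow> \<exists>L\<in>B. \<exists>L'\<in>B'. tower_orth L L'"
proof (induction a arbitrary: B W a' B' W' rule: R_induct)
  case (less a)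
  note outer = less.IH
  show ?case using less.prems
  proof (induction a' arbitrary: B' W' rule: R_induct)
    case (less a')
    have F: "a \<in> Field R" "a' \<in> Field R" using less.prems chain_props by blast+
    from R_trichotomy[OF this] show ?case
    proof (elim disjE)
      assume eq: "a = a'"
      obtain b b' where b: "gg a b W" "tag a b \<subseteq> B" "gg a b' W'" "tag a b' \<subseteq> B'"
        using chain_top less.prems eq by blast
      then obtain l l' where l: "l \<in> b" "l' \<in> b'" "ox a l l'"
        using frame.disj[OF frames[OF F(1)]] less.prems(3) by blast
      have "tower_orth (a # fst l, snd l) (a # fst l', snd l')"
        using l F by (auto simp: tower_orth_def)
      moreover have "(a # fst l, snd l) \<in> B" "(a # fst l', snd l') \<in> B'"
        using l b by (auto simp: tag_def split_beta)
      ultimately show ?thesis by blast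
    next
      assume lt: "a \<in> underS R a'"
      obtain a1 B1 W1 where c: "chain a1 B1 W1" "B1 \<subseteq> B'" "a1 \<in> underS R a'"
        "\<And>Q. K a' Q \<Longrightarrow> Q \<inter> W1 \<noteq> {} \<Longrightarrow> Q \<inter> W' \<noteq> {}"
        using chain_below[OF less.prems(2)] lt by blast
      have "K a' W" using J_K[OF lt] chain_props[OF less.prems(1)] by blast
      then have "W \<inter> W1 = {}" using c(4) less.prems(3) by blast
      then show ?thesis using less.IH[OF c(3) less.prems(1) c(1)] c(2) by blast
    next
      assume lt: "a' \<in> underS R a"
      obtain a1 B1 W1 where c: "chain a1 B1 W1" "B1 \<subseteq> B" "a1 \<in> underS R a"
        "\<And>Q. K a Q \<Longrightarrow> Q \<inter> W1 \<noteq> {} \<Longrightarrow> Q \<inter> W \<noteq> {}"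
        using chain_below[OF less.prems(1)] lt by blast
      have "K a W'" using J_K[OF lt] chain_props[OF less.prems(2)] by blast
      then have "W1 \<inter> W' = {}" using c(4) less.prems(3) by blast
      then show ?thesis using outer[OF c(3) c(1) less.prems(2)] c(2) by blast
    qed
  qed
qed

text \<open>The choice runs from the top down: a good pair inside \<open>G\<close>, then
  \<open>P\<close> by skeletality, then a lower chain ending inside \<open>P\<close>. Only the top
  open set has to lie in \<open>G\<close>.\<close>

lemma chain_dense:
  "a \<in> Field R \<Longrightarrow> J a G \<Longrightarrow> G \<noteq> {} \<Longrightarrow> \<exists>B W. chain a B W \<and> W \<subseteq> G"
proof (induction a arbitrary: G rule: R_induct)
  case (less a)
  interpret F: frame X "hh a" "\<lambda>l. Suc (snd l)" "ox a" "J a" "gg a"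
    by (rule frames[OF less.prems(1)])
  obtain b W where b: "gg a b W" "W \<subseteq> G" "level_coz a b \<inter> W \<noteq> {}"
    using F.dense[OF less.prems(2,3)] by (auto simp: F.coz_def level_coz_def)
  show ?case
  proof (cases "underS R a = {}")
    case True
    then show ?thesis using bottom less.prems(1) b by blast
  next
    case False
    have "J a (level_coz a b \<inter> W)"
      using goodD[OF less.prems(1) b(1)] J_level_coz less.prems(1) J_Int by blast
    from skeletal[OF less.prems(1) False this b(3)] obtain P where
      P: "K a P" "P \<noteq> {}" "\<And>Q. K a Q \<Longrightarrow> Q \<inter> P \<noteq> {} \<Longrightarrow> Q \<inter> (level_coz a b \<inter> W) \<noteq> {}"
      by blast
    from K_base[OF less.prems(1) False P(1,2)] obtain a' V where
      V: "a' \<in> underS R a" "J a' V" "V \<noteq> {}" "V \<subseteq> P" by blast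
    have "a' \<in> Field R" using V(1) by (auto simp: underS_def Field_def)
    from less.IH[OF V(1) this V(2,3)] obtain B W' where "chain a' B W'" "W' \<subseteq> V" by blast
    then have "chain a (B \<union> tag a b) W"
      using less.prems(1) V b P(3) by (intro extend) blast+
    then show ?thesis using b(2) by blast
  qed
qed

lemma tower_frame:
  "frame X tower_h (\<lambda>l. Suc (snd l)) tower_orth T (\<lambda>B W. \<exists>a. chain a B W)"
proof -
  have ls: "letter_system X (hh a) (\<lambda>l. Suc (snd l)) (ox a)" if "a \<in> Field R" for a
    using frames[OF that] by (simp add: frame_def)
  have "finite {L. Suc (snd L) \<le> n \<and> tower_orth L L'}" for n L'
  proof (cases "\<exists>a\<in>Field R. \<exists>l'. fst L' = a # l'")
    case True
    then obtain a l' where a: "a \<in> Field R" "fst L' = a # l'" by blast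
    \<comment> \<open>Orthogonal letters share their first level, so finiteness is inherited from a
      single frame.\<close>
    have "{L. Suc (snd L) \<le> n \<and> tower_orth L L'} \<subseteq>
        tag a {l. Suc (snd l) \<le> n \<and> ox a l (l', snd L')}"
      using a by (force simp: tower_orth_def tag_def)
    moreover have "finite (tag a {l. Suc (snd l) \<le> n \<and> ox a l (l', snd L')})"
      unfolding tag_def using letter_system.orth_fin[OF ls[OF a(1)]] by (intro finite_imageI)
    ultimately show ?thesis by (rule finite_subset)
  next
    case False
    then have "{L. Suc (snd L) \<le> n \<and> tower_orth L L'} = {}" by (auto simp: tower_orth_def)
    then show ?thesis by (simp only: finite.emptyI)
  qed
  moreover have "continuous_map X euclideanreal (tower_h L)" for L
    using letter_system.h_cont[OF ls] by (cases "fst L") (simp_all add: tower_h_def[abs_def])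
  moreover have "0 \<le> tower_h L x" for L x
    using letter_system.h_nonneg[OF ls] by (auto simp: tower_h_def split: list.split)
  moreover have "tower_h L x \<le> (1/2) ^ Suc (snd L)" for L x
  proof -
    have "hh a (l, snd L) x \<le> (1/2) ^ Suc (snd L)" if "a \<in> Field R" for a l
      using letter_system.h_le[OF ls[OF that], of "(l, snd L)" x] by simp
    then show ?thesis by (auto simp: tower_h_def split: list.split)
  qed
  ultimately have tower_ls: "letter_system X tower_h (\<lambda>l. Suc (snd l)) tower_orth"
    by unfold_locales auto
  have coz: "letter_system.coz X tower_h B = tower_coz B" for B
    using letter_system.coz_def[OF tower_ls] by (simp add: tower_coz_def)
  show ?thesis
  proof (intro frame.intro tower_ls frame_axioms.intro)
    fix L :: "'i list \<times> nat"
    show "T {x \<in> topspace X. 0 < tower_h L x}"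
    proof (cases "\<exists>a\<in>Field R. \<exists>l. fst L = a # l")
      case True
      then obtain a l where "a \<in> Field R" "fst L = a # l" by blast
      then show ?thesis using frame.op_coz[OF frames] J_T by (simp add: tower_h_def)
    next
      case False
      then have "{x \<in> topspace X. 0 < tower_h L x} = {}"
        by (auto simp: tower_h_def split: list.splits)
      then show ?thesis using T_empty by (simp only:)
    qed
  next
    fix L L' x assume "tower_orth L L'" "x \<in> topspace X"
    then show "tower_h L x = 0 \<or> tower_h L' x = 0"
      using frame.orth[OF frames] by (fastforce simp: tower_orth_def tower_h_def)
  next
    fix B W assume "\<exists>a. chain a B W"
    then show "finite B \<and> T W" using chain_props J_T by blast
  next
    fix G assume "T G" "G \<noteq> {}"
    then obtain a V where "a \<in> Field R" "J a V" "V \<noteq> {}" "V \<subseteq> G" using T_base by blast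
    then show "\<exists>B W. (\<exists>a. chain a B W) \<and> W \<subseteq> G \<and> W \<inter> letter_system.coz X tower_h B \<noteq> {}"
      using chain_dense[of a V] chain_props unfolding coz by blast
  next
    fix B W B' W' assume "\<exists>a. chain a B W" "\<exists>a. chain a B' W'" "W \<inter> W' = {}"
    then show "\<exists>L\<in>B. \<exists>L'\<in>B'. tower_orth L L'" using chain_disj by blast
  qed
qed

end

section \<open>Skeletal spectra\<close>

text \<open>A sequence of operations serves two purposes: closing under upper bounds, and closing
  under upper bounds together with countably many choices in \<open>skeletal\<close>.\<close>

inductive_set generated :: "(nat \<Rightarrow> 'i \<Rightarrow> 'i \<Rightarrow> 'i) \<Rightarrow> 'i set \<Rightarrow> 'i set"
  for F :: "nat \<Rightarrow> 'i \<Rightarrow> 'i \<Rightarrow> 'i" and S :: "'i set" where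
  base: "a \<in> S \<Longrightarrow> a \<in> generated F S"
| step: "a \<in> generated F S \<Longrightarrow> b \<in> generated F S \<Longrightarrow> F k a b \<in> generated F S"

lemma generated_mono:
  assumes "S \<subseteq> T" shows "generated F S \<subseteq> generated F T"
proof
  fix a assume "a \<in> generated F S"
  then show "a \<in> generated F T"
    by induction (use assms in \<open>auto intro: generated.intros\<close>)
qed

lemma generated_subset:
  assumes "S \<subseteq> I" "\<And>k a b. a \<in> I \<Longrightarrow> b \<in> I \<Longrightarrow> F k a b \<in> I"
  shows "generated F S \<subseteq> I"
proof
  fix a assume "a \<in> generated F S"
  then show "a \<in> I" by induction (use assms in auto)
qed

lemma countable_generated:
  assumes "countable S" shows "countable (generated F S)"
proof -
  define G where "G n = ((\<lambda>A. A \<union> (\<lambda>(k, a, b). F k a b) ` (UNIV \<times> A \<times> A)) ^^ n) S" for n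
  have G_Suc: "G (Suc n) = G n \<union> (\<lambda>(k, a, b). F k a b) ` (UNIV \<times> G n \<times> G n)" for n
    by (simp add: G_def)
  have "countable (G n)" for n
    by (induction n) (simp_all add: G_Suc assms, simp add: G_def assms)
  moreover have "generated F S \<subseteq> (\<Union>n. G n)"
  proof (rule generated_subset)
    show "S \<subseteq> (\<Union>n. G n)" by (auto simp: G_def intro!: exI[of _ 0])
    have mono: "G m \<subseteq> G n" if "m \<le> n" for m n
      by (rule lift_Suc_mono_le[OF _ that]) (auto simp: G_Suc)
    fix k a b assume "a \<in> (\<Union>n. G n)" "b \<in> (\<Union>n. G n)"
    then obtain m n where "a \<in> G m" "b \<in> G n" by blast
    then have "a \<in> G (max m n)" "b \<in> G (max m n)"
      using mono[of m "max m n"] mono[of n "max m n"] by auto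
    then have "F k a b \<in> G (Suc (max m n))" by (force simp: G_Suc)
    then show "F k a b \<in> (\<Union>n. G n)" by blast
  qed
  ultimately show ?thesis
    by (meson countable_UN countable_subset countableI_type)
qed

text \<open>Second countability in functional form. The bounds hold on the whole type, as
  \<open>letter_system\<close> also asks of letters.\<close>

definition cozero_base :: "'b topology \<Rightarrow> (nat \<Rightarrow> 'b \<Rightarrow> real) \<Rightarrow> bool" where
  "cozero_base Y g \<longleftrightarrow> (\<forall>k. continuous_map Y euclideanreal (g k)) \<and>
    (\<forall>k y. 0 \<le> g k y \<and> g k y \<le> 1) \<and>
    (\<forall>G y. openin Y G \<and> y \<in> G \<longrightarrow> (\<exists>k. 0 < g k y \<and> {z \<in> topspace Y. 0 < g k z} \<subseteq> G))"

text \<open>Truncated tents around a dense sequence \<open>q\<close>: on \<open>M\<close>, the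
  function coded by \<open>(m, n)\<close> is positive exactly on the ball of radius
  \<open>1 / Suc n\<close> about \<open>q m\<close>.\<close>

lemma separable_metrizable_cozero_base:
  assumes "metrizable_space Y" "separable_space Y"
  shows "\<exists>g. cozero_base Y g"
proof -
  obtain M d where M: "Metric_space M d" "Y = Metric_space.mtopology M d"
    using assms(1) by (auto simp: metrizable_space_def)
  interpret Metric_space M d by (rule M)
  obtain D where D: "countable D" "D \<subseteq> M" "mtopology closure_of D = M"
    using assms(2) by (auto simp: M(2) separable_space_def)
  show ?thesis
  proof (cases "M = {}")
    case True
    have "y \<notin> G" if "openin Y G" for G y
      using openin_subset[OF that] True unfolding M(2) topspace_mtopology by blast
    then show ?thesis by (intro exI[of _ "\<lambda>_ _. 0"]) (auto simp: cozero_base_def)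
  next
    case False
    then have "D \<noteq> {}" using D(3) by auto
    define q where "q = from_nat_into D"
    have qD: "q m \<in> D" for m using \<open>D \<noteq> {}\<close> by (simp add: q_def from_nat_into)
    define g where "g k y = (case prod_decode k of (m, n) \<Rightarrow>
      min 1 (max 0 (1 / real (Suc n) - d (q m) y)))" for k y
    have g_eq: "g (prod_encode (m, n)) y = min 1 (max 0 (1 / real (Suc n) - d (q m) y))" for m n y
      by (simp add: g_def)
    have "continuous_map Y euclideanreal (g k)" for k
    proof -
      obtain m n where k: "k = prod_encode (m, n)" by (metis prod_decode_inverse surj_pair)
      have "continuous_map mtopology euclideanreal (\<lambda>y. d (q m) y)"
        using continuous_on_mdist[of "q m" Self] qD[of m] D(2)
        by (auto simp: mtopology_of_def)
      then show ?thesis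
        unfolding k g_eq[abs_def] M(2)
        by (intro continuous_map_real_min continuous_map_real_max continuous_map_diff) auto
    qed
    moreover have "0 \<le> g k y \<and> g k y \<le> 1" for k y
      by (simp add: g_def split: prod.split)
    moreover have "\<exists>k. 0 < g k y \<and> {z \<in> topspace Y. 0 < g k z} \<subseteq> G"
      if G: "openin Y G" "y \<in> G" for G y
    proof -
      obtain r where r: "0 < r" "mball y r \<subseteq> G" and yM: "y \<in> M"
        using G unfolding M(2) openin_mtopology by blast
      \<comment> \<open>Half of \<open>r\<close>, because the ball about a nearby dense point must
        stay within \<open>r\<close> of \<open>y\<close>.\<close>
      obtain n where n: "1 / real (Suc n) < r / 2"
        using r(1) nat_approx_posE[of "r/2"] by auto
      have "y \<in> mtopology closure_of D" using D(3) yM by simp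
      then obtain z where z: "z \<in> D" "z \<in> mball y (1 / real (Suc n))"
        unfolding metric_closure_of using of_nat_0_less_iff[of "Suc n"] zero_less_divide_1_iff
        by blast
      obtain m where m: "q m = z"
        using z(1) from_nat_into_surj[OF D(1)] by (auto simp: q_def)
      have "0 < g (prod_encode (m, n)) y"
        using z m by (simp add: g_eq commute)
      moreover have "x \<in> G" if x: "x \<in> M" "0 < g (prod_encode (m, n)) x" for x
      proof -
        have "d z x < 1 / real (Suc n)" using x m by (simp add: g_eq)
        moreover have "d y z < 1 / real (Suc n)" "z \<in> M" using z by auto
        ultimately have "d y x < r" using triangle[of y z x] n x yM by linarith
        then show ?thesis using r x yM by auto
      qed
      ultimately show ?thesis by (auto simp: M(2))
    qed
    ultimately show ?thesis unfolding cozero_base_def by blast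
  qed
qed

section \<open>Topologies generated by sets of projections\<close>

text \<open>
  \<open>u\<close> picks upper bounds, and \<open>seq_sup\<close> is all that is used of sigma-completeness and of the
  embedding of \<open>Xs b\<close> into the limit of an inverse sequence.
\<close>

locale spectrum =
  fixes X :: "'a topology" and A :: "'i set" and r :: "'i rel" and Xs :: "'i \<Rightarrow> 'b topology"
    and p :: "'i \<Rightarrow> 'i \<Rightarrow> 'b \<Rightarrow> 'b" and f :: "'i \<Rightarrow> 'a \<Rightarrow> 'b" and u :: "'i \<Rightarrow> 'i \<Rightarrow> 'i"
    and g :: "'i \<Rightarrow> nat \<Rightarrow> 'b \<Rightarrow> real"
  assumes u: "a \<in> A \<Longrightarrow> b \<in> A \<Longrightarrow> u a b \<in> A \<and> (a, u a b) \<in> r \<and> (b, u a b) \<in> r"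
    and r_A: "r \<subseteq> A \<times> A" and r_trans: "trans r"
    and f_cont: "a \<in> A \<Longrightarrow> continuous_map X (Xs a) (f a)"
    and f_surj: "a \<in> A \<Longrightarrow> f a ` topspace X = topspace (Xs a)"
    and p_f: "(a, b) \<in> r \<Longrightarrow> x \<in> topspace X \<Longrightarrow> p b a (f b x) = f a x"
    and p_skeletal: "(a, b) \<in> r \<Longrightarrow> skeletal_map (Xs b) (Xs a) (p b a)"
    and X_base: "openin X U \<Longrightarrow> x \<in> U \<Longrightarrow>
      \<exists>a\<in>A. \<exists>V. openin (Xs a) V \<and> f a x \<in> V \<and> {y \<in> topspace X. f a y \<in> V} \<subseteq> U"
    and seq_sup: "(\<And>n. s n \<in> A \<and> (s n, s (Suc n)) \<in> r) \<Longrightarrow>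
      \<exists>b\<in>A. (\<forall>n. (s n, b) \<in> r) \<and> (\<forall>G y. openin (Xs b) G \<and> y \<in> G \<longrightarrow>
        (\<exists>n::nat. \<exists>V. openin (Xs (s n)) V \<and> p b (s n) y \<in> V \<and>
          {z \<in> topspace (Xs b). p b (s n) z \<in> V} \<subseteq> G))"
    and g: "a \<in> A \<Longrightarrow> cozero_base (Xs a) (g a)"
begin

lemma g_cont: "a \<in> A \<Longrightarrow> continuous_map (Xs a) euclideanreal (g a k)"
  and g_bounds: "a \<in> A \<Longrightarrow> 0 \<le> g a k y \<and> g a k y \<le> 1"
  and g_base: "a \<in> A \<Longrightarrow> openin (Xs a) G \<Longrightarrow> y \<in> G \<Longrightarrow>
      \<exists>k. 0 < g a k y \<and> {z \<in> topspace (Xs a). 0 < g a k z} \<subseteq> G"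
  using g[of a] by (simp_all add: cozero_base_def)

lemma p_cont: "(a, b) \<in> r \<Longrightarrow> continuous_map (Xs b) (Xs a) (p b a)"
  using p_skeletal by (simp add: skeletal_map_def)

definition cyl :: "'i \<Rightarrow> 'b set \<Rightarrow> 'a set" where
  "cyl a V = {x \<in> topspace X. f a x \<in> V}"

text \<open>Unions of cylinders over single indices of \<open>I\<close>. They form the topology
  generated by the projections in \<open>I\<close> once \<open>I\<close> is closed under
  \<open>u\<close>.\<close>

definition open_over :: "'i set \<Rightarrow> 'a set \<Rightarrow> bool" where
  "open_over I W \<longleftrightarrow> W \<subseteq> topspace X \<and>
     (\<forall>x\<in>W. \<exists>a\<in>I. \<exists>V. openin (Xs a) V \<and> x \<in> cyl a V \<and> cyl a V \<subseteq> W)"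

definition closed_index :: "'i set \<Rightarrow> bool" where
  "closed_index I \<longleftrightarrow> I \<noteq> {} \<and> I \<subseteq> A \<and> (\<forall>a\<in>I. \<forall>b\<in>I. u a b \<in> I)"

abbreviation cl :: "'i set \<Rightarrow> 'i set" where
  "cl S \<equiv> generated (\<lambda>_. u) S"

lemma closed_index_cl: "S \<subseteq> A \<Longrightarrow> S \<noteq> {} \<Longrightarrow> closed_index (cl S)"
  unfolding closed_index_def using generated_subset[of S A "\<lambda>_. u"] u
  by (auto intro: generated.intros)

lemma open_over_empty: "open_over I {}"
  by (simp add: open_over_def)

lemma open_over_topspace: "closed_index I \<Longrightarrow> open_over I (topspace X)"
  unfolding open_over_def closed_index_def cyl_def
  using f_cont by (fastforce simp: continuous_map_def Pi_iff)

lemma open_over_mono: "I \<subseteq> I' \<Longrightarrow> open_over I W \<Longrightarrow> open_over I' W"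
  unfolding open_over_def by blast

lemma openin_cyl: "a \<in> A \<Longrightarrow> openin (Xs a) V \<Longrightarrow> openin X (cyl a V)"
  unfolding cyl_def using f_cont openin_continuous_map_preimage by blast

lemma open_over_cyl: "a \<in> I \<Longrightarrow> openin (Xs a) V \<Longrightarrow> open_over I (cyl a V)"
  unfolding open_over_def by (auto simp: cyl_def)

lemma open_over_openin: "I \<subseteq> A \<Longrightarrow> open_over I W \<Longrightarrow> openin X W"
  unfolding open_over_def by (subst openin_subopen) (meson openin_cyl subsetD)

lemma open_over_all: "open_over A = openin X"
proof
  fix W
  have "open_over A W" if W: "openin X W"
    unfolding open_over_def
  proof (intro conjI ballI)
    show "W \<subseteq> topspace X" using W openin_subset by blast
    fix x assume x: "x \<in> W"
    then have "x \<in> topspace X" using W openin_subset by blast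
    then show "\<exists>a\<in>A. \<exists>V. openin (Xs a) V \<and> x \<in> cyl a V \<and> cyl a V \<subseteq> W"
      using X_base[OF W x] unfolding cyl_def by blast
  qed
  then show "open_over A W = openin X W" using open_over_openin by blast
qed

lemma cyl_refine:
  assumes "(a, c) \<in> r" "openin (Xs a) V"
  shows "\<exists>V'. openin (Xs c) V' \<and> cyl c V' = cyl a V"
proof (intro exI conjI)
  show "openin (Xs c) {z \<in> topspace (Xs c). p c a z \<in> V}"
    using p_cont[OF assms(1)] assms(2) openin_continuous_map_preimage by blast
  have "c \<in> A" using assms r_A by blast
  then have "f c x \<in> topspace (Xs c)" if "x \<in> topspace X" for x
    using f_surj that by blast
  then show "cyl c {z \<in> topspace (Xs c). p c a z \<in> V} = cyl a V"
    using p_f[OF assms(1)] by (auto simp: cyl_def)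
qed

lemma open_over_Int:
  assumes I: "closed_index I" and W: "open_over I W" "open_over I W'"
  shows "open_over I (W \<inter> W')"
  unfolding open_over_def
proof (intro conjI ballI)
  show "W \<inter> W' \<subseteq> topspace X" using W by (auto simp: open_over_def)
  fix x assume "x \<in> W \<inter> W'"
  then obtain a V b V' where
    a: "a \<in> I" "openin (Xs a) V" "x \<in> cyl a V" "cyl a V \<subseteq> W" and
    b: "b \<in> I" "openin (Xs b) V'" "x \<in> cyl b V'" "cyl b V' \<subseteq> W'"
    using W unfolding open_over_def by blast
  have c: "u a b \<in> I" "(a, u a b) \<in> r" "(b, u a b) \<in> r"
    using I a b u unfolding closed_index_def by blast+
  obtain Y Y' where Y: "openin (Xs (u a b)) Y" "cyl (u a b) Y = cyl a V"
    "openin (Xs (u a b)) Y'" "cyl (u a b) Y' = cyl b V'"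
    using cyl_refine[OF c(2) a(2)] cyl_refine[OF c(3) b(2)] by blast
  have "cyl (u a b) (Y \<inter> Y') = cyl a V \<inter> cyl b V'" using Y by (auto simp: cyl_def)
  then show "\<exists>a\<in>I. \<exists>V. openin (Xs a) V \<and> x \<in> cyl a V \<and> cyl a V \<subseteq> W \<inter> W'"
    using a b c Y by (intro bexI[of _ "u a b"] exI[of _ "Y \<inter> Y'"]) auto
qed

text \<open>Folding an enumeration of \<open>J\<close> with \<open>u\<close> gives an increasing
  sequence inside \<open>J\<close> that passes above each element of \<open>J\<close>, so the upper
  bound that \<open>seq_sup\<close> gives for the sequence serves all of \<open>J\<close>.\<close>

lemma countable_sup:
  assumes J: "closed_index J" "countable J"
  shows "\<exists>b\<in>A. (\<forall>a\<in>J. (a, b) \<in> r) \<and> (\<forall>G y. openin (Xs b) G \<and> y \<in> G \<longrightarrow>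
    (\<exists>a\<in>J. \<exists>V. openin (Xs a) V \<and> p b a y \<in> V \<and> {z \<in> topspace (Xs b). p b a z \<in> V} \<subseteq> G))"
proof -
  define j where "j = from_nat_into J"
  have j: "j n \<in> J" for n using J by (simp add: j_def closed_index_def from_nat_into)
  define s where "s = rec_nat (j 0) (\<lambda>n t. u t (j (Suc n)))"
  have s0: "s 0 = j 0" and sS: "s (Suc n) = u (s n) (j (Suc n))" for n
    by (simp_all add: s_def)
  have sJ: "s n \<in> J" for n
    by (induction n) (use j J in \<open>auto simp: s0 sS closed_index_def\<close>)
  have J_A: "a \<in> A" if "a \<in> J" for a using J that by (auto simp: closed_index_def)
  have "s n \<in> A \<and> (s n, s (Suc n)) \<in> r" for n
    using sJ J_A u[of "s n" "j (Suc n)"] j by (simp add: sS)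
  from seq_sup[of s, OF this] obtain b where b: "b \<in> A" and b': "(\<forall>n. (s n, b) \<in> r) \<and>
      (\<forall>G y. openin (Xs b) G \<and> y \<in> G \<longrightarrow> (\<exists>n::nat. \<exists>V. openin (Xs (s n)) V \<and>
        p b (s n) y \<in> V \<and> {z \<in> topspace (Xs b). p b (s n) z \<in> V} \<subseteq> G))"
    by (rule bexE)
  have b_up: "(s n, b) \<in> r" for n using b' by simp
  have b_base: "\<exists>a\<in>J. \<exists>V. openin (Xs a) V \<and> p b a y \<in> V \<and>
       {z \<in> topspace (Xs b). p b a z \<in> V} \<subseteq> G" if "openin (Xs b) G" "y \<in> G" for G y
  proof -
    from conjunct2[OF b', rule_format, OF conjI, OF that] obtain n V where
      "openin (Xs (s n)) V \<and> p b (s n) y \<in> V \<and> {z \<in> topspace (Xs b). p b (s n) z \<in> V} \<subseteq> G"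
      by (elim exE)
    then show ?thesis using sJ[of n] by (intro bexI[of _ "s n"] exI[of _ V])
  qed
  have "(a, b) \<in> r" if a: "a \<in> J" for a
  proof -
    obtain n where n: "a = j n" using from_nat_into_surj[OF J(2) a] by (auto simp: j_def)
    show ?thesis
    proof (cases n)
      case 0
      then show ?thesis using b_up[of 0] n s0 by simp
    next
      case (Suc m)
      have "(j n, s n) \<in> r" using u[of "s m" "j n"] sJ j J_A by (simp add: Suc sS)
      then show ?thesis using b_up[of n] r_trans n by (blast dest: transD)
    qed
  qed
  then show ?thesis using b b_base by (intro bexI[of _ b]) simp_all
qed

text \<open>
  If no \<open>P\<close> works, every basic open set over an index \<open>a \<in> I\<close> contains a cylinder over some index
  \<open>t a k \<in> I\<close> that misses \<open>U\<close>. The closure \<open>J\<close> of one index under \<open>t\<close> and \<open>u\<close> is countable,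
  and over its supremum \<open>b\<close> the image of \<open>U\<close> would be nowhere dense.
\<close>

lemma skeletal:
  assumes I: "closed_index I" and U: "openin X U" "U \<noteq> {}"
  shows "\<exists>P. open_over I P \<and> P \<noteq> {} \<and> (\<forall>Q. open_over I Q \<and> Q \<inter> P \<noteq> {} \<longrightarrow> Q \<inter> U \<noteq> {})"
proof (rule ccontr)
  assume contra: "\<not> ?thesis"
  have I_A: "I \<subseteq> A" using I by (simp add: closed_index_def)
  define B where "B a k = {z \<in> topspace (Xs a). 0 < g a k z}" for a k
  have oB: "openin (Xs a) (B a k)" if "a \<in> A" for a k
    using g_cont[OF that] by (simp add: B_def continuous_map_upper_lower_semicontinuous_lt)
  have "\<exists>c\<in>I. B a k \<noteq> {} \<longrightarrow>
      (\<exists>V. openin (Xs c) V \<and> cyl c V \<noteq> {} \<and> cyl c V \<subseteq> cyl a (B a k) \<and> cyl c V \<inter> U = {})"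
    if a: "a \<in> I" for a k
  proof (cases "B a k = {}")
    case False
    have aA: "a \<in> A" using a I_A by blast
    have op: "open_over I (cyl a (B a k))" using a aA oB open_over_cyl by blast
    obtain z where z: "z \<in> B a k" using False by blast
    then have "z \<in> f a ` topspace X" using f_surj[OF aA] by (simp add: B_def)
    then have "cyl a (B a k) \<noteq> {}" using z by (auto simp: cyl_def)
    then obtain Q where Q: "open_over I Q" "Q \<inter> cyl a (B a k) \<noteq> {}" "Q \<inter> U = {}"
      using contra op by blast
    then obtain x where "x \<in> Q \<inter> cyl a (B a k)" by blast
    moreover have "open_over I (Q \<inter> cyl a (B a k))" by (rule open_over_Int[OF I Q(1) op])
    ultimately obtain c V where "c \<in> I" "openin (Xs c) V" "x \<in> cyl c V"
      "cyl c V \<subseteq> Q \<inter> cyl a (B a k)" unfolding open_over_def by blast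
    then show ?thesis using Q(3) by blast
  qed (use a in blast)
  then obtain t where t: "\<And>a k. a \<in> I \<Longrightarrow> t a k \<in> I \<and> (B a k \<noteq> {} \<longrightarrow>
      (\<exists>V. openin (Xs (t a k)) V \<and> cyl (t a k) V \<noteq> {} \<and> cyl (t a k) V \<subseteq> cyl a (B a k) \<and>
        cyl (t a k) V \<inter> U = {}))"
    by metis
  obtain a0 where a0: "a0 \<in> I" using I by (auto simp: closed_index_def)
  \<comment> \<open>Operation 0 is \<open>u\<close>; operation \<open>Suc k\<close> is the choice
    \<open>t _ k\<close> in binary form. Closing one index under all of them stays
    countable.\<close>
  define F where "F k a b = (case k of 0 \<Rightarrow> u a b | Suc k \<Rightarrow> t a k)" for k a b
  define J where "J = generated F {a0}"
  have F0: "u a b = F 0 a b" and FS: "t a k = F (Suc k) a b" for a b k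
    by (simp_all add: F_def)
  have JI: "J \<subseteq> I"
    unfolding J_def
    by (rule generated_subset) (use a0 I t in \<open>auto simp: F_def closed_index_def split: nat.split\<close>)
  have "closed_index J"
    unfolding closed_index_def
    using JI I_A by (auto simp: J_def F0 intro: generated.intros)
  moreover have "countable J" unfolding J_def by (rule countable_generated) simp
  ultimately obtain b where b: "b \<in> A" and b': "(\<forall>a\<in>J. (a, b) \<in> r) \<and>
    (\<forall>G y. openin (Xs b) G \<and> y \<in> G \<longrightarrow>
    (\<exists>a\<in>J. \<exists>V. openin (Xs a) V \<and> p b a y \<in> V \<and> {z \<in> topspace (Xs b). p b a z \<in> V} \<subseteq> G))"
    by (rule countable_sup[THEN bexE])
  have b_up: "(a, b) \<in> r" if "a \<in> J" for a using b' that by simp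
  have b_base: "\<exists>a\<in>J. \<exists>V. openin (Xs a) V \<and> p b a y \<in> V \<and>
      {z \<in> topspace (Xs b). p b a z \<in> V} \<subseteq> G" if "openin (Xs b) G" "y \<in> G" for G y
    using conjunct2[OF b', rule_format, OF conjI, OF that] .
  have "open_over A U" using U by (simp add: open_over_all)
  moreover obtain x where "x \<in> U" using U by blast
  ultimately obtain d V where d: "d \<in> A" "openin (Xs d) V" "x \<in> cyl d V" "cyl d V \<subseteq> U"
    unfolding open_over_def by blast
  \<comment> \<open>Over \<open>e\<close> a cylinder inside \<open>U\<close> becomes an open set
    \<open>Y\<close>, whose image under the skeletal map to \<open>Xs b\<close> is dense in some
    non-empty open \<open>G\<close>.\<close>
  define e where "e = u d b"
  have e: "e \<in> A" "(d, e) \<in> r" "(b, e) \<in> r" using u d(1) b by (simp_all add: e_def)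
  obtain Y where Y: "openin (Xs e) Y" "cyl e Y = cyl d V" using cyl_refine[OF e(2) d(2)] by blast
  have "Y \<noteq> {}" using Y(2) d(3) by (auto simp: cyl_def)
  then have "Xs b interior_of (Xs b closure_of (p e b ` Y)) \<noteq> {}"
    using p_skeletal[OF e(3)] Y(1) by (simp add: skeletal_map_def)
  then obtain y where "y \<in> Xs b interior_of (Xs b closure_of (p e b ` Y))" by blast
  then obtain G where G: "openin (Xs b) G" "y \<in> G" "G \<subseteq> Xs b closure_of (p e b ` Y)"
    by (auto simp: interior_of_def)
  obtain a V1 where a: "a \<in> J" "openin (Xs a) V1" "p b a y \<in> V1"
    "{z \<in> topspace (Xs b). p b a z \<in> V1} \<subseteq> G"
    using b_base[OF G(1,2)] by blast
  have aA: "a \<in> A" "a \<in> I" using a JI I_A by blast+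
  obtain k where k: "0 < g a k (p b a y)" "B a k \<subseteq> V1"
    using g_base[OF aA(1) a(2,3)] by (auto simp: B_def)
  have "p b a y \<in> B a k"
    using k(1) a(2,3) openin_subset by (auto simp: B_def)
  then obtain V2 where V2: "openin (Xs (t a k)) V2" "cyl (t a k) V2 \<noteq> {}"
    "cyl (t a k) V2 \<subseteq> cyl a (B a k)" "cyl (t a k) V2 \<inter> U = {}"
    using t[OF aA(2), of k] by blast
  \<comment> \<open>\<open>J\<close> is closed under \<open>t\<close>, so the cylinder that misses
    \<open>U\<close> is already visible over \<open>b\<close>, inside \<open>G\<close>.\<close>
  have "t a k \<in> J" using a(1) unfolding J_def FS[of a k a] by (blast intro: generated.step)
  then have tb: "(t a k, b) \<in> r" by (rule b_up)
  obtain w where w: "w \<in> cyl (t a k) V2" using V2(2) by blast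
  then have wX: "w \<in> topspace X" by (simp add: cyl_def)
  have wb: "f b w \<in> topspace (Xs b)" using wX f_surj[OF b] by blast
  have "p b a (f b w) \<in> V1"
    using w V2(3) k(2) p_f[OF b_up[OF a(1)] wX] by (auto simp: cyl_def)
  then have wcl: "f b w \<in> Xs b closure_of (p e b ` Y)" using a(4) G(3) wb by blast
  define D where "D = {z \<in> topspace (Xs b). p b (t a k) z \<in> V2}"
  have oD: "openin (Xs b) D"
    unfolding D_def using p_cont[OF tb] V2(1) openin_continuous_map_preimage by blast
  have wD: "f b w \<in> D"
    using w wb p_f[OF tb wX] by (simp add: D_def cyl_def)
  have "\<exists>q. q \<in> p e b ` Y \<and> q \<in> D"
    using wcl oD wD unfolding in_closure_of by (elim conjE allE[of _ D]) blast
  then obtain z where z: "z \<in> Y" "p b (t a k) (p e b z) \<in> V2"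
    by (auto simp: D_def)
  have "z \<in> f e ` topspace X" unfolding f_surj[OF e(1)] using z(1) openin_subset[OF Y(1)] by blast
  then obtain x' where x': "x' \<in> topspace X" "z = f e x'" by blast
  have "x' \<in> cyl (t a k) V2"
    using z(2) x' p_f[OF e(3)] p_f[OF tb] by (simp add: cyl_def)
  moreover have "x' \<in> U" using x' z(1) Y(2) d(4) by (auto simp: cyl_def)
  ultimately show False using V2(4) by blast
qed

section \<open>Frames over countable and over arbitrary index sets\<close>

text \<open>Countably many functions \<open>v n\<close> give a base of cozero sets. Boxes are single
  letters, orthogonality is true disjointness, and only finitely many numbers stay below a given
  weight.\<close>

lemma countable_frame:
  assumes I: "closed_index I" "countable I"
  shows "\<exists>(h :: 'i list \<times> nat \<Rightarrow> 'a \<Rightarrow> real) orth good.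
    frame X h (\<lambda>l. Suc (snd l)) orth (open_over I) good"
proof -
  have I_A: "I \<subseteq> A" "I \<noteq> {}" using I by (simp_all add: closed_index_def)
  define c where "c = from_nat_into I"
  have cI: "c n \<in> I" for n using I_A by (simp add: c_def from_nat_into)
  then have cA: "c n \<in> A" for n using I_A by blast
  define v where "v n x = (case prod_decode n of (m, k) \<Rightarrow> g (c m) k (f (c m) x))" for n x
  have v_cont: "continuous_map X euclideanreal (v n)" for n
  proof -
    obtain m k where n: "prod_decode n = (m, k)" by fastforce
    from continuous_map_compose[OF f_cont[OF cA] g_cont[OF cA]] show ?thesis
      by (simp add: v_def[abs_def] n comp_def)
  qed
  have v_bounds: "0 \<le> v n x \<and> v n x \<le> 1" for n x
    using g_bounds[OF cA] by (simp add: v_def split: prod.split)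
  have v_open: "open_over I {x \<in> topspace X. 0 < v n x}" for n
  proof -
    obtain m k where n: "prod_decode n = (m, k)" by fastforce
    have "openin (Xs (c m)) {z \<in> topspace (Xs (c m)). 0 < g (c m) k z}"
      using g_cont[OF cA] by (simp add: continuous_map_upper_lower_semicontinuous_lt)
    from open_over_cyl[OF cI this] show ?thesis
      using f_surj[OF cA] by (auto simp: cyl_def v_def n elim!: back_subst[of "open_over I"])
  qed
  have v_base: "\<exists>n x. x \<in> topspace X \<and> 0 < v n x \<and> {x \<in> topspace X. 0 < v n x} \<subseteq> G"
    if G: "open_over I G" "G \<noteq> {}" for G
  proof -
    obtain x a V where a: "a \<in> I" "openin (Xs a) V" "x \<in> cyl a V" "cyl a V \<subseteq> G"
      using G unfolding open_over_def by blast
    have aA: "a \<in> A" using a I_A by blast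
    obtain k where k: "0 < g a k (f a x)" "{z \<in> topspace (Xs a). 0 < g a k z} \<subseteq> V"
      using g_base[OF aA a(2)] a(3) by (auto simp: cyl_def)
    obtain m where m: "c m = a" using from_nat_into_surj[OF I(2) a(1)] by (auto simp: c_def)
    have "v (prod_encode (m, k)) y = g a k (f a y)" for y by (simp add: v_def m)
    moreover have "f a y \<in> topspace (Xs a)" if "y \<in> topspace X" for y
      using f_surj[OF aA] that by blast
    then have "{y \<in> topspace X. 0 < g a k (f a y)} \<subseteq> G"
      using k(2) a(4) by (auto simp: cyl_def)
    ultimately show ?thesis
      using k(1) a(3) by (intro exI[of _ "prod_encode (m, k)"] exI[of _ x]) (simp add: cyl_def)
  qed
  define h :: "'i list \<times> nat \<Rightarrow> 'a \<Rightarrow> real" where "h l x = (1/2) ^ Suc (snd l) * v (snd l) x" for l x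
  have h_pos: "0 < h l x \<longleftrightarrow> 0 < v (snd l) x" for l x by (simp add: h_def zero_less_mult_iff)
  \<comment> \<open>Requiring the empty list leaves one letter per number; otherwise infinitely many
    letters of one weight could be orthogonal to the same letter.\<close>
  define orth :: "'i list \<times> nat \<Rightarrow> 'i list \<times> nat \<Rightarrow> bool" where
    "orth l l' \<longleftrightarrow> fst l = [] \<and> fst l' = [] \<and> (\<forall>x\<in>topspace X. v (snd l) x = 0 \<or> v (snd l') x = 0)"
    for l l'
  define good :: "('i list \<times> nat) set \<Rightarrow> 'a set \<Rightarrow> bool" where
    "good b W \<longleftrightarrow> (\<exists>n. b = {([], n)} \<and> W = {x \<in> topspace X. 0 < v n x})" for b W
  have h_cont: "continuous_map X euclideanreal (h l)" for l
    unfolding h_def[abs_def] by (intro continuous_map_real_mult_left v_cont)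
  have h_bounds: "0 \<le> h l x" "h l x \<le> (1/2) ^ Suc (snd l)" for l x
    using v_bounds mult_left_le[of "v (snd l) x" "(1/2) ^ Suc (snd l)"] by (simp_all add: h_def)
  have "finite {l. Suc (snd l) \<le> n \<and> orth l l'}" for n l'
    by (rule finite_subset[of _ "{[]} \<times> {..n}"]) (auto simp: orth_def)
  then have ls: "letter_system X h (\<lambda>l. Suc (snd l)) orth"
    using h_cont h_bounds by unfold_locales auto
  have coz: "letter_system.coz X h b = {x \<in> topspace X. \<forall>l\<in>b. 0 < v (snd l) x}" for b
    using letter_system.coz_def[OF ls] by (simp add: h_pos)
  have "frame X h (\<lambda>l. Suc (snd l)) orth (open_over I) good"
  proof (intro frame.intro ls frame_axioms.intro)
    fix l show "open_over I {x \<in> topspace X. 0 < h l x}" by (simp add: h_pos v_open)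
  next
    fix l l' x assume "orth l l'" "x \<in> topspace X"
    then show "h l x = 0 \<or> h l' x = 0" by (auto simp: orth_def h_def)
  next
    fix b W assume "good b W" then show "finite b \<and> open_over I W"
      using v_open by (auto simp: good_def)
  next
    fix G assume "open_over I G" "G \<noteq> {}"
    then obtain n x where n: "x \<in> topspace X" "0 < v n x" "{x \<in> topspace X. 0 < v n x} \<subseteq> G"
      using v_base by blast
    then show "\<exists>b W. good b W \<and> W \<subseteq> G \<and> W \<inter> letter_system.coz X h b \<noteq> {}"
      unfolding coz good_def
      by (intro exI[of _ "{([], n)}"] exI[of _ "{x \<in> topspace X. 0 < v n x}"]) auto
  next
    fix b W b' W' assume "good b W" "good b' W'" "W \<inter> W' = {}"
    then show "\<exists>l\<in>b. \<exists>l'\<in>b'. orth l l'"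
      using v_bounds by (fastforce simp: good_def orth_def less_le)
  qed
  then show ?thesis by blast
qed

text \<open>An element of \<open>cl D\<close> is generated by finitely many elements of
  \<open>D\<close>, and initial segments are nested, so one segment contains them all.\<close>

lemma cl_level:
  assumes R: "Well_order R" and D: "D \<subseteq> Field R" and c: "c \<in> cl D"
  shows "\<exists>a\<in>D. c \<in> cl (under R a)"
  using c
proof induction
  case (base a)
  then have "a \<in> under R a"
    using R D by (auto simp: under_def order_on_defs refl_on_def)
  then show ?case using base by (blast intro: generated.base)
next
  case (step a b k)
  then obtain a' b' where ab: "a' \<in> D" "a \<in> cl (under R a')" "b' \<in> D" "b \<in> cl (under R b')"
    by blast
  have "(a', b') \<in> R \<or> (b', a') \<in> R"
  proof -
    have "a' \<in> Field R" "b' \<in> Field R" using ab D by blast+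
    then show ?thesis
      using R unfolding order_on_defs refl_on_def total_on_def by (cases "a' = b'") blast+
  qed
  moreover have "trans R" using R by (simp add: order_on_defs)
  ultimately have "under R a' \<subseteq> under R b' \<or> under R b' \<subseteq> under R a'"
    using under_incr[of R] by blast
  then have "cl (under R a') \<subseteq> cl (under R b') \<or> cl (under R b') \<subseteq> cl (under R a')"
    using generated_mono by blast
  then have "\<exists>e\<in>D. a \<in> cl (under R e) \<and> b \<in> cl (under R e)"
    using ab by blast
  then show ?case using generated.step[of a "\<lambda>_. u" _ b] by blast
qed

lemma under_underS:
  assumes "Well_order R" "a \<in> underS R b"
  shows "under R a \<subseteq> underS R b"
proof
  fix c assume "c \<in> under R a"
  moreover have "trans R" "antisym R" using assms(1) by (simp_all add: order_on_defs)
  ultimately show "c \<in> underS R b"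
    using assms(2) by (auto simp: under_def underS_def dest: transD antisymD)
qed

text \<open>
  The induction is on the cardinality of \<open>S\<close> rather than of the possibly larger set \<open>cl S\<close>:
  in a cardinal well-order of \<open>S\<close> every initial segment has smaller cardinality than \<open>S\<close>.
\<close>

lemma exists_frame:
  "S \<subseteq> A \<Longrightarrow> S \<noteq> {} \<Longrightarrow> \<exists>(h :: 'i list \<times> nat \<Rightarrow> 'a \<Rightarrow> real) orth good.
     frame X h (\<lambda>l. Suc (snd l)) orth (open_over (cl S)) good"
proof (induction S rule: wf_induct_rule[OF wf_inv_image[OF wf_ordLess, of card_of]])
  case (1 S)
  show ?case
  proof (cases "countable S")
    case True
    show ?thesis
      by (rule countable_frame[OF closed_index_cl[OF "1.prems"] countable_generated[OF True]])
  next
    case False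
    then have inf: "infinite S" using countable_finite by blast
    define R where "R = card_of S"
    have R: "Card_order R" "Field R = S"
      unfolding R_def by (rule card_of_Card_order, rule Field_card_of)
    have wo: "Well_order R" using R(1) by (simp add: card_order_on_def)
    have under_less: "(card_of (under R a), card_of S) \<in> ordLess" if a: "a \<in> S" for a
    proof -
      \<comment> \<open>An infinite cardinal has no greatest element, so the segment up to
        \<open>a\<close> lies strictly below some \<open>b\<close> and has smaller cardinality than
        \<open>S\<close>.\<close>
      obtain b where b: "b \<in> Field R" "a \<noteq> b" "(a, b) \<in> R"
        using infinite_Card_order_limit[OF R(1), of a] inf a R(2) by auto
      have "under R a \<subseteq> underS R b" using under_underS[OF wo] b by (simp add: underS_def)
      then have "(card_of (under R a), card_of (underS R b)) \<in> ordLeq" by (rule card_of_mono1)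
      moreover have "(card_of (underS R b), R) \<in> ordLess" by (rule card_of_underS[OF R(1) b(1)])
      ultimately show ?thesis unfolding R_def by (rule ordLeq_ordLess_trans)
    qed
    have under_S: "under R a \<subseteq> S" "underS R a \<subseteq> S" for a
      using R(2) by (auto simp: under_def underS_def Field_def)
    have under_refl: "a \<in> under R a" if "a \<in> S" for a
      using wo that R(2) by (auto simp: under_def order_on_defs refl_on_def)
    have "\<exists>h orth good. frame X (h :: 'i list \<times> nat \<Rightarrow> 'a \<Rightarrow> real) (\<lambda>l. Suc (snd l)) orth
        (open_over (cl (under R a))) good" if a: "a \<in> S" for a
      using "1.IH"[of "under R a"] under_less[OF a] under_S(1)[of a] under_refl[OF a] "1.prems"
      by (auto simp: in_inv_image)
    then obtain hh :: "'i \<Rightarrow> 'i list \<times> nat \<Rightarrow> 'a \<Rightarrow> real" and ox gg where fr: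
      "\<And>a. a \<in> S \<Longrightarrow> frame X (hh a) (\<lambda>l. Suc (snd l)) (ox a) (open_over (cl (under R a))) (gg a)"
      by metis
    have closed: "closed_index (cl (under R a))" if "a \<in> S" for a
      using closed_index_cl under_S(1)[of a] under_refl[OF that] "1.prems"(1) by blast
    have closedS: "closed_index (cl (underS R a))" if "underS R a \<noteq> {}" for a
      using closed_index_cl under_S(2)[of a] that "1.prems"(1) by blast
    have clA: "cl (under R a) \<subseteq> A" if "a \<in> S" for a
      using closed[OF that] by (simp add: closed_index_def)
    have base: "\<exists>a\<in>D. \<exists>V. open_over (cl (under R a)) V \<and> V \<noteq> {} \<and> V \<subseteq> U"
      if D: "D \<subseteq> S" and U: "open_over (cl D) U" "U \<noteq> {}" for D U
    proof -
      obtain x c V where c: "c \<in> cl D" "openin (Xs c) V" "x \<in> cyl c V" "cyl c V \<subseteq> U"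
        using U unfolding open_over_def by blast
      obtain a where a: "a \<in> D" "c \<in> cl (under R a)"
        using cl_level[OF wo _ c(1)] D R(2) by blast
      then show ?thesis using open_over_cyl[OF a(2) c(2)] c by blast
    qed
    have "frame_tower X R (\<lambda>a. open_over (cl (under R a))) (\<lambda>a. open_over (cl (underS R a)))
        (open_over (cl S)) hh ox gg"
    proof (rule frame_tower.intro, unfold R(2))
      show "well_order_on S R" using wo R(2) by simp
      show "open_over (cl S) {}" by (rule open_over_empty)
    next
      fix a assume a: "a \<in> S"
      show "frame X (hh a) (\<lambda>l. Suc (snd l)) (ox a) (open_over (cl (under R a))) (gg a)"
        by (rule fr[OF a])
      show "open_over (cl (under R a)) (topspace X)" by (rule open_over_topspace[OF closed[OF a]])
      fix U assume U: "open_over (cl (under R a)) U"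
      show "open_over (cl S) U"
        using U open_over_mono generated_mono[OF under_S(1)] by blast
      fix V assume "open_over (cl (under R a)) V"
      then show "open_over (cl (under R a)) (U \<inter> V)" by (rule open_over_Int[OF closed[OF a] U])
    next
      fix a a' U assume a: "a \<in> underS R a'" "open_over (cl (under R a)) U"
      have "under R a \<subseteq> underS R a'" by (rule under_underS[OF wo a(1)])
      then show "open_over (cl (underS R a')) U" using a(2) open_over_mono generated_mono by blast
    next
      fix a U assume a: "open_over (cl (underS R a)) U"
      have "underS R a \<subseteq> under R a" by (auto simp: under_def underS_def)
      then show "open_over (cl (under R a)) U" using a open_over_mono generated_mono by blast
    next
      fix a U assume a: "a \<in> S" "underS R a \<noteq> {}" "open_over (cl (under R a)) U" "U \<noteq> {}"
      show "\<exists>P. open_over (cl (underS R a)) P \<and> P \<noteq> {} \<and>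
          (\<forall>Q. open_over (cl (underS R a)) Q \<and> Q \<inter> P \<noteq> {} \<longrightarrow> Q \<inter> U \<noteq> {})"
        by (rule skeletal[OF closedS[OF a(2)] open_over_openin[OF clA[OF a(1)] a(3)] a(4)])
    next
      fix U assume "open_over (cl S) U" "U \<noteq> {}"
      then show "\<exists>a\<in>S. \<exists>V. open_over (cl (under R a)) V \<and> V \<noteq> {} \<and> V \<subseteq> U"
        using base by blast
    next
      fix a U assume "open_over (cl (underS R a)) U" "U \<noteq> {}"
      then show "\<exists>a'\<in>underS R a. \<exists>V. open_over (cl (under R a')) V \<and> V \<noteq> {} \<and> V \<subseteq> U"
        using base under_S(2) by blast
    qed
    from frame_tower.tower_frame[OF this] show ?thesis by blast
  qed
qed

lemma weakly_kappa_metrizable: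
  assumes "A \<noteq> {}" shows "weakly_kappa_metrizable X"
proof -
  have "cl A = A"
    using generated_subset[of A A "\<lambda>_. u"] u by (auto intro: generated.base)
  then obtain h orth good where
    "frame X (h :: 'i list \<times> nat \<Rightarrow> 'a \<Rightarrow> real) (\<lambda>l. Suc (snd l)) orth (openin X) good"
    using exists_frame[of A] assms open_over_all by auto
  then show ?thesis by (rule frame.weakly_kappa_metrizable) simp
qed

end

section \<open>Embeddings into inverse limits\<close>

lemma directed_finite_upper:
  assumes "directed_set A r" "finite F" "F \<subseteq> A"
  shows "\<exists>c\<in>A. \<forall>a\<in>F. (a, c) \<in> r"
  using assms(2,3)
proof (induction F rule: finite_induct)
  case empty
  then show ?case using assms(1) by (auto simp: directed_set_def)
next
  case (insert a F)
  then obtain c where c: "c \<in> A" "\<forall>b\<in>F. (b, c) \<in> r" by blast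
  moreover obtain e where "e \<in> A" "(a, e) \<in> r" "(c, e) \<in> r"
    using assms(1) insert.prems c(1) unfolding directed_set_def by blast
  moreover have "trans r" using assms(1) by (simp add: directed_set_def preorder_on_def)
  ultimately show ?case by (metis insert_iff transD)
qed

text \<open>A basic open set of the product restricts finitely many coordinates; pulled back to a
  common upper bound \<open>c\<close>, these become one cylinder. This applies both to
  \<open>X\<close> and to \<open>Xs b\<close> inside the limit of a sequence.\<close>

lemma inverse_limit_embedding:
  assumes e: "embedding_map Y (inverse_limit A r Xs p) e" and A: "directed_set A r"
    and p: "\<And>a b. (a, b) \<in> r \<Longrightarrow> continuous_map (Xs b) (Xs a) (p b a)"
  shows inverse_limit_embedding_cont: "a \<in> A \<Longrightarrow> continuous_map Y (Xs a) (\<lambda>y. e y a)"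
    and inverse_limit_embedding_thread: "(a, b) \<in> r \<Longrightarrow> y \<in> topspace Y \<Longrightarrow> p b a (e y b) = e y a"
    and inverse_limit_embedding_base: "openin Y U \<Longrightarrow> y \<in> U \<Longrightarrow>
      \<exists>a\<in>A. \<exists>V. openin (Xs a) V \<and> e y a \<in> V \<and> {z \<in> topspace Y. e z a \<in> V} \<subseteq> U"
proof -
  let ?T = "{x. \<forall>a b. (a, b) \<in> r \<longrightarrow> p b a (x b) = x a}"
  let ?P = "product_topology Xs A"
  have hom: "homeomorphic_map Y (subtopology (subtopology ?P ?T) (e ` topspace Y)) e"
    using e by (simp add: embedding_map_def inverse_limit_def)
  have cont: "continuous_map Y (subtopology ?P ?T) e"
    using homeomorphic_imp_continuous_map[OF hom] continuous_map_in_subtopology by blast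
  then have contP: "continuous_map Y ?P e" and T: "y \<in> topspace Y \<Longrightarrow> e y \<in> ?T" for y
    unfolding continuous_map_in_subtopology by blast+
  show cont_a: "continuous_map Y (Xs a) (\<lambda>y. e y a)" if "a \<in> A" for a
    using contP that by (simp add: continuous_map_componentwise)
  show thread: "p b a (e y b) = e y a" if "(a, b) \<in> r" "y \<in> topspace Y" for a b y
    using T that by blast
  show "\<exists>a\<in>A. \<exists>V. openin (Xs a) V \<and> e y a \<in> V \<and> {z \<in> topspace Y. e z a \<in> V} \<subseteq> U"
    if U: "openin Y U" "y \<in> U" for U y
  proof -
    have UY: "U \<subseteq> topspace Y" using U openin_subset by blast
    have "openin (subtopology (subtopology ?P ?T) (e ` topspace Y)) (e ` U)"
      using homeomorphic_map_openness_eq[OF hom] U by blast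
    then obtain W where W: "openin ?P W" "e ` U = W \<inter> ?T \<inter> e ` topspace Y"
      by (auto simp: openin_subtopology)
    have yW: "e y \<in> W" using W(2) U(2) by blast
    from W(1)[unfolded openin_product_topology_alt, THEN bspec, OF yW] obtain B where B:
      "finite {a \<in> A. B a \<noteq> topspace (Xs a)}"
      "\<And>a. a \<in> A \<Longrightarrow> openin (Xs a) (B a)" "e y \<in> Pi\<^sub>E A B" "Pi\<^sub>E A B \<subseteq> W"
      by (elim exE conjE) blast
    define F where "F = {a \<in> A. B a \<noteq> topspace (Xs a)}"
    obtain c where c: "c \<in> A" "\<forall>a\<in>F. (a, c) \<in> r"
      using directed_finite_upper[OF A, of F] B(1) by (auto simp: F_def)
    define V where "V = topspace (Xs c) \<inter> \<Inter>((\<lambda>a. {z \<in> topspace (Xs c). p c a z \<in> B a}) ` F)"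
    have "openin (Xs c) {z \<in> topspace (Xs c). p c a z \<in> B a}" if "a \<in> F" for a
      using openin_continuous_map_preimage[OF p] c(2) B(2) that by (auto simp: F_def)
    then have "openin (Xs c) V"
      unfolding V_def using B(1) by (cases "F = {}") (auto simp: F_def[symmetric])
    moreover have ytop: "e z c \<in> topspace (Xs c)" if "z \<in> topspace Y" for z
      using cont_a[OF c(1)] that by (auto simp: continuous_map_def)
    have "e y c \<in> V"
      using ytop UY U(2) thread c(2) B(3) by (auto simp: V_def F_def PiE_iff subset_iff)
    moreover have "z \<in> U" if z: "z \<in> topspace Y" "e z c \<in> V" for z
    proof -
      have "e z a \<in> B a" if a: "a \<in> A" for a
      proof (cases "a \<in> F")
        case True
        then show ?thesis using z thread[of a c z] c(2) by (auto simp: V_def)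
      next
        case False
        then show ?thesis using a cont_a[OF a] z(1) by (auto simp: F_def continuous_map_def)
      qed
      moreover have "e z \<in> extensional A"
        using contP z(1) by (auto simp: continuous_map_def PiE_iff)
      ultimately have "e z \<in> W" using B(4) by (auto simp: PiE_iff subset_iff)
      then have "e z \<in> e ` U" using W(2) T z(1) by blast
      moreover have "inj_on e (topspace Y)"
        using hom by (simp add: homeomorphic_eq_everything_map)
      ultimately show ?thesis using UY z(1) by (auto dest: inj_onD)
    qed
    ultimately show ?thesis using c(1) by blast
  qed
qed

section \<open>The spectrum of a skeletally generated space\<close>

theorem corollary4p2:
  fixes X :: "'a topology"
  assumes "tychonoff_space X"
    and "skeletally_generated TYPE('i) TYPE('b) X"
  shows "weakly_kappa_metrizable X"
proof -
  obtain A :: "'i set" and r and Xs :: "'i \<Rightarrow> 'b topology" and p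
    where gen: "skeletally_generating X A r Xs p"
    using assms(2) by (auto simp: skeletally_generated_def)
  have sys: "inverse_system A r Xs p"
    and metr: "\<And>a. a \<in> A \<Longrightarrow> metrizable_space (Xs a) \<and> separable_space (Xs a)"
    and skel: "\<And>a b. (a, b) \<in> r \<Longrightarrow> skeletal_map (Xs b) (Xs a) (p b a)"
    and sig: "sigma_complete A r"
    using gen by (simp_all add: skeletally_generating_def)
  have chains: "embedding_map (Xs b)
      (inverse_limit UNIV {(m, n). m \<le> n} (\<lambda>n. Xs (s n)) (\<lambda>n m. p (s n) (s m)))
      (\<lambda>x n. p b (s n) x)"
    if "\<And>n::nat. s n \<in> A \<and> (s n, s (Suc n)) \<in> r" "is_supremum A r (range s) b" for s b
    using gen that by (simp add: skeletally_generating_def Let_def)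
  obtain e where e: "embedding_map X (inverse_limit A r Xs p) e"
    "\<And>a. a \<in> A \<Longrightarrow> (\<lambda>x. e x a) ` topspace X = topspace (Xs a)"
    using gen by (auto simp: skeletally_generating_def)
  have dir: "directed_set A r"
    and pc: "\<And>a b. (a, b) \<in> r \<Longrightarrow> continuous_map (Xs b) (Xs a) (p b a)"
    using sys by (simp_all add: inverse_system_def)
  have ne: "A \<noteq> {}" and rA: "r \<subseteq> A \<times> A" and refl: "\<And>a. a \<in> A \<Longrightarrow> (a, a) \<in> r" and tr: "trans r"
    using dir by (auto simp: directed_set_def preorder_on_def refl_on_def)
  have "\<exists>c. a \<in> A \<longrightarrow> b \<in> A \<longrightarrow> c \<in> A \<and> (a, c) \<in> r \<and> (b, c) \<in> r" for a b
    using dir unfolding directed_set_def by blast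
  then obtain u where u: "\<And>a b. a \<in> A \<Longrightarrow> b \<in> A \<Longrightarrow> u a b \<in> A \<and> (a, u a b) \<in> r \<and> (b, u a b) \<in> r"
    by metis
  have "\<exists>g. \<forall>a. a \<in> A \<longrightarrow> cozero_base (Xs a) (g a)"
    by (intro choice allI) (use separable_metrizable_cozero_base metr in blast)
  then obtain g where g: "\<And>a. a \<in> A \<Longrightarrow> cozero_base (Xs a) (g a)" by blast
  have sup: "\<exists>b\<in>A. (\<forall>n. (s n, b) \<in> r) \<and> (\<forall>G y. openin (Xs b) G \<and> y \<in> G \<longrightarrow>
        (\<exists>n::nat. \<exists>V. openin (Xs (s n)) V \<and> p b (s n) y \<in> V \<and>
          {z \<in> topspace (Xs b). p b (s n) z \<in> V} \<subseteq> G))"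
    if s: "\<And>n. s n \<in> A \<and> (s n, s (Suc n)) \<in> r" for s
  proof -
    have le: "(s m, s n) \<in> r" if "m \<le> n" for m n
      using that by (induction rule: dec_induct) (use s refl tr in \<open>auto dest: transD\<close>)
    \<comment> \<open>The range of an increasing sequence is a countable chain, so
      sigma-completeness supplies the supremum at which \<open>chains\<close> applies.\<close>
    have "total_on (range s) r"
      unfolding total_on_def using le by (metis (no_types, lifting) imageE nle_le)
    moreover have "range s \<subseteq> A" using s by blast
    ultimately have "\<exists>b. is_supremum A r (range s) b"
      using sig[unfolded sigma_complete_def, rule_format, of "range s"] by simp
    then obtain b where b: "is_supremum A r (range s) b" ..
    have "directed_set UNIV {(m, n). m \<le> (n::nat)}"
      by (auto simp: directed_set_def preorder_on_def refl_on_def trans_def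
          intro: max.cobounded1 max.cobounded2)
    from inverse_limit_embedding_base[OF chains[of s b, OF s b] this]
    have "\<exists>n V. openin (Xs (s n)) V \<and> p b (s n) y \<in> V \<and>
          {z \<in> topspace (Xs b). p b (s n) z \<in> V} \<subseteq> G" if "openin (Xs b) G" "y \<in> G" for G y
      using that le pc by auto
    then show ?thesis using b by (auto simp: is_supremum_def intro!: bexI[of _ b])
  qed
  interpret spectrum X A r Xs p "\<lambda>a x. e x a" u g
  proof (rule spectrum.intro)
    show "u a b \<in> A \<and> (a, u a b) \<in> r \<and> (b, u a b) \<in> r" if "a \<in> A" "b \<in> A" for a b
      by (rule u[OF that])
    show "continuous_map X (Xs a) (\<lambda>x. e x a)" if "a \<in> A" for a
      by (rule inverse_limit_embedding_cont[OF e(1) dir pc that])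
    show "(\<lambda>x. e x a) ` topspace X = topspace (Xs a)" if "a \<in> A" for a
      by (rule e(2)[OF that])
    show "p b a (e x b) = e x a" if "(a, b) \<in> r" "x \<in> topspace X" for a b x
      by (rule inverse_limit_embedding_thread[OF e(1) dir pc that])
    show "skeletal_map (Xs b) (Xs a) (p b a)" if "(a, b) \<in> r" for a b
      by (rule skel[OF that])
    show "\<exists>a\<in>A. \<exists>V. openin (Xs a) V \<and> e x a \<in> V \<and> {y \<in> topspace X. e y a \<in> V} \<subseteq> U"
      if "openin X U" "x \<in> U" for U x
      by (rule inverse_limit_embedding_base[OF e(1) dir pc that])
    show "cozero_base (Xs a) (g a)" if "a \<in> A" for a
      by (rule g[OF that])
  qed (rule rA tr sup; assumption)+
  show ?thesis by (rule weakly_kappa_metrizable[OF ne])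
qed

end
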